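(* Let $F=\alpha^{1+m}\beta^{-m}$, $m\neq0$, be an $m$-Kropina metric of Berwald type on a smooth manifold $M$ with $\dim M>2$, built from a (pseudo-)Riemannian metric $a$ and a 1-form $b$. If $b$ is nowhere null, i.e. $|b|^2=a^{ij}b_ib_j\neq0$ at every point of $M$, then $F$ is (globally) metrizable.
   Context: Finsler metrics. Let $M$ be a smooth manifold of dimension $n$, with local coordinates $x^i$ and induced coordinates $(x,y)$ on $TM$ (a tangent vector is $y^i\partial_i$); write $\partial_i=\partial/\partial x^i$, $\bar\partial_i=\partial/\partial y^i$. A conic subbundle of $TM$ is an open subset $\mathcal A\subset TM$ such that $(x,\lambda y)\in\mathcal A$ for all $(x,y)\in\mathcal A$, $\lambda>0$, and whose projection to $M$ is all of $M$. A Finsler metric on $\mathcal A$ is a smooth map $F:\mathcal A\to[0,\infty)$ with $F(x,\lambda y)=\lambda F(x,y)$ for $\lambda>0$ and with nondegenerate fundamental tensor $g_{ij}=\bar\partial_i\bar\partial_j(\tfrac12F^2)$. Berwald metrics. The canonical nonlinear connection has coefficients $N^j_i=\tfrac14\bar\partial_i\big[g^{jk}(y^l\partial_l\bar\partial_kF^2-\partial_kF^2)\big]$. $F$ is of Berwald type if $N^k_i=\Gamma^k_{ij}(x)y^j$ for functions $\Gamma^k_{ij}$ on the base; these are then the Christoffel symbols of a torsion-free affine connection on $M$, called the affine connection of $F$. Metrizability. A Berwald metric $F$ on $M$ is (globally) metrizable if its affine connection is the Levi-Civita connection of some pseudo-Riemannian metric on $M$. $m$-Kropina metrics. An $m$-Kropina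 metric is a Finsler metric of the form $F=\alpha^{1+m}\beta^{-m}$ with $\alpha=\sqrt{|a_{ij}y^iy^j|}$, $\beta=b_iy^i$, where $a$ is a (pseudo-)Riemannian metric of arbitrary signature and $b$ a 1-form on $M$, and $m\in\mathbb R$; $b$ is then nowhere vanishing. The trivial case $m=0$ is excluded. Indices are raised and lowered with $a_{ij}$, and $\mathring\nabla$, $\mathring\Gamma$ denote the Levi-Civita connection of $a$ and its Christoffel symbols. Known fact: for $n>2$, $F$ is of Berwald type iff there is a smooth vector field $f^i$ on $M$ with $\mathring\nabla_j b_i = m (f_k b^k)a_{ij} + b_i f_j - m f_i b_j$. In that case $f$ is unique and the affine connection of $F$ is $\Gamma^\ell_{ij}=\mathring\Gamma^\ell_{ij}+m a^{\ell k}(a_{ij}f_k-a_{jk}f_i-a_{ki}f_j)$. *)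

theory Defs
  imports "HOL-Analysis.Analysis"
begin

primrec Ck_on :: "nat \<Rightarrow> 'e set \<Rightarrow> ('e::euclidean_space \<Rightarrow> 'f::real_normed_vector) \<Rightarrow> bool" where
  "Ck_on 0 S f \<longleftrightarrow> continuous_on S f"
| "Ck_on (Suc k) S f \<longleftrightarrow>
     (\<forall>x\<in>S. f differentiable (at x)) \<and> (\<forall>v. Ck_on k S (\<lambda>x. frechet_derivative f (at x) v))"

definition smooth_on :: "'e set \<Rightarrow> ('e::euclidean_space \<Rightarrow> 'f::real_normed_vector) \<Rightarrow> bool" where
  "smooth_on S f \<longleftrightarrow> (\<forall>k. Ck_on k S f)"

definition dir_deriv :: "'e \<Rightarrow> ('e::euclidean_space \<Rightarrow> real) \<Rightarrow> 'e \<Rightarrow> real" where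
  "dir_deriv v f z = frechet_derivative f (at z) v"

text \<open>A chart is a pair of its domain and its coordinate map; the values of the coordinate map
  outside the domain are irrelevant. The dimension of the manifold is \<open>CARD('n)\<close>.\<close>

type_synonym ('a, 'n) chart = "'a set \<times> ('a \<Rightarrow> real ^ 'n)"

definition chart_dom :: "('a, 'n) chart \<Rightarrow> 'a set" where
  "chart_dom c = fst c"

definition chart_map :: "('a, 'n) chart \<Rightarrow> 'a \<Rightarrow> real ^ 'n" where
  "chart_map c = snd c"

definition chart_img :: "('a, 'n) chart \<Rightarrow> (real ^ 'n) set" where
  "chart_img c = chart_map c ` chart_dom c"

definition chart_inv :: "('a, 'n) chart \<Rightarrow> real ^ 'n \<Rightarrow> 'a" where
  "chart_inv c = inv_into (chart_dom c) (chart_map c)"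

definition transition :: "('a, 'n) chart \<Rightarrow> ('a, 'n) chart \<Rightarrow> real ^ 'n \<Rightarrow> real ^ 'n" where
  "transition c d = chart_map d \<circ> chart_inv c"

definition is_chart :: "'a topology \<Rightarrow> ('a, 'n::finite) chart \<Rightarrow> bool" where
  "is_chart X c \<longleftrightarrow> openin X (chart_dom c) \<and> open (chart_img c) \<and>
     homeomorphic_map (subtopology X (chart_dom c)) (top_of_set (chart_img c)) (chart_map c)"

definition second_countable_space :: "'a topology \<Rightarrow> bool" where
  "second_countable_space X \<longleftrightarrow>
     (\<exists>\<B>. countable \<B> \<and> (\<forall>V\<in>\<B>. openin X V) \<and>
        (\<forall>U x. openin X U \<and> x \<in> U \<longrightarrow> (\<exists>V\<in>\<B>. x \<in> V \<and> V \<subseteq> U)))"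

text \<open>The atlas need not be maximal. All notions below that refer to the charts of the atlas
  are compatible with smooth changes of coordinates.\<close>

definition smooth_manifold :: "'a topology \<Rightarrow> ('a, 'n::finite) chart set \<Rightarrow> bool" where
  "smooth_manifold X \<A> \<longleftrightarrow>
     Hausdorff_space X \<and> second_countable_space X \<and>
     (\<forall>c\<in>\<A>. is_chart X c) \<and> (\<Union>c\<in>\<A>. chart_dom c) = topspace X \<and>
     (\<forall>c\<in>\<A>. \<forall>d\<in>\<A>. smooth_on (chart_map c ` (chart_dom c \<inter> chart_dom d)) (transition c d))"

text \<open>A tangent vector at \<open>p\<close> is the family of its component vectors in all charts around \<open>p\<close>,
  which transform with the Jacobians of the coordinate changes. The family is set to zero at
  charts that do not contain \<open>p\<close>, so that every tangent vector is represented exactly once.\<close>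

type_synonym ('a, 'n) tvec = "('a, 'n) chart \<Rightarrow> real ^ 'n"

definition tangent_space :: "('a, 'n::finite) chart set \<Rightarrow> 'a \<Rightarrow> ('a, 'n) tvec set" where
  "tangent_space \<A> p =
     {v. (\<forall>c\<in>\<A>. \<forall>d\<in>\<A>. p \<in> chart_dom c \<and> p \<in> chart_dom d \<longrightarrow>
            v d = frechet_derivative (transition c d) (at (chart_map c p)) (v c)) \<and>
         (\<forall>c. \<not> (c \<in> \<A> \<and> p \<in> chart_dom c) \<longrightarrow> v c = 0)}"

definition tvec_lincomb :: "real \<Rightarrow> ('a, 'n::finite) tvec \<Rightarrow> real \<Rightarrow> ('a, 'n) tvec \<Rightarrow> ('a, 'n) tvec" where
  "tvec_lincomb r v s w = (\<lambda>c. r *\<^sub>R v c + s *\<^sub>R w c)"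

definition tvec_scale :: "real \<Rightarrow> ('a, 'n::finite) tvec \<Rightarrow> ('a, 'n) tvec" where
  "tvec_scale r v = (\<lambda>c. r *\<^sub>R v c)"

definition tangent_bundle ::
    "'a topology \<Rightarrow> ('a, 'n::finite) chart set \<Rightarrow> ('a \<times> ('a, 'n) tvec) set" where
  "tangent_bundle X \<A> = Sigma (topspace X) (tangent_space \<A>)"

text \<open>\<open>tangent_vector \<A> c p y\<close> is the tangent vector \<open>y\<^sup>i\<partial>\<^sub>i\<close> at \<open>p\<close>, where \<open>\<partial>\<^sub>i\<close> are the coordinate
  vector fields of the chart \<open>c\<close>; \<open>bundle_point \<A> c (x, y)\<close> is the point of the tangent bundle with
  induced coordinates \<open>(x, y)\<close>.\<close>

definition tangent_vector ::
    "('a, 'n::finite) chart set \<Rightarrow> ('a, 'n) chart \<Rightarrow> 'a \<Rightarrow> real ^ 'n \<Rightarrow> ('a, 'n) tvec" where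
  "tangent_vector \<A> c p y =
     (\<lambda>d. if d \<in> \<A> \<and> p \<in> chart_dom d
          then frechet_derivative (transition c d) (at (chart_map c p)) y else 0)"

definition coord_vector ::
    "('a, 'n::finite) chart set \<Rightarrow> ('a, 'n) chart \<Rightarrow> 'a \<Rightarrow> 'n \<Rightarrow> ('a, 'n) tvec" where
  "coord_vector \<A> c p i = tangent_vector \<A> c p (axis i 1)"

definition bundle_point ::
    "('a, 'n::finite) chart set \<Rightarrow> ('a, 'n) chart \<Rightarrow> (real ^ 'n) \<times> (real ^ 'n) \<Rightarrow> 'a \<times> ('a, 'n) tvec"
  where
  "bundle_point \<A> c z = (chart_inv c (fst z), tangent_vector \<A> c (chart_inv c (fst z)) (snd z))"

definition local_domain ::
    "('a, 'n::finite) chart set \<Rightarrow> ('a \<times> ('a, 'n) tvec) set \<Rightarrow> ('a, 'n) chart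
      \<Rightarrow> ((real ^ 'n) \<times> (real ^ 'n)) set" where
  "local_domain \<A> A c = {z. fst z \<in> chart_img c \<and> bundle_point \<A> c z \<in> A}"

definition local_rep ::
    "('a, 'n::finite) chart set \<Rightarrow> ('a \<times> ('a, 'n) tvec \<Rightarrow> real) \<Rightarrow> ('a, 'n) chart
      \<Rightarrow> (real ^ 'n) \<times> (real ^ 'n) \<Rightarrow> real" where
  "local_rep \<A> F c = F \<circ> bundle_point \<A> c"

definition metric_comp ::
    "('a, 'n::finite) chart set \<Rightarrow> ('a \<Rightarrow> ('a, 'n) tvec \<Rightarrow> ('a, 'n) tvec \<Rightarrow> real)
      \<Rightarrow> ('a, 'n) chart \<Rightarrow> 'n \<Rightarrow> 'n \<Rightarrow> real ^ 'n \<Rightarrow> real" where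
  "metric_comp \<A> a c i j x =
     (let p = chart_inv c x in a p (coord_vector \<A> c p i) (coord_vector \<A> c p j))"

definition form_comp ::
    "('a, 'n::finite) chart set \<Rightarrow> ('a \<Rightarrow> ('a, 'n) tvec \<Rightarrow> real)
      \<Rightarrow> ('a, 'n) chart \<Rightarrow> 'n \<Rightarrow> real ^ 'n \<Rightarrow> real" where
  "form_comp \<A> b c i x = (let p = chart_inv c x in b p (coord_vector \<A> c p i))"

definition linear_on_tangent ::
    "('a, 'n::finite) chart set \<Rightarrow> 'a \<Rightarrow> (('a, 'n) tvec \<Rightarrow> real) \<Rightarrow> bool" where
  "linear_on_tangent \<A> p l \<longleftrightarrow>
     (\<forall>v\<in>tangent_space \<A> p. \<forall>w\<in>tangent_space \<A> p. \<forall>r s.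
        l (tvec_lincomb r v s w) = r * l v + s * l w)"

definition one_form ::
    "'a topology \<Rightarrow> ('a, 'n::finite) chart set \<Rightarrow> ('a \<Rightarrow> ('a, 'n) tvec \<Rightarrow> real) \<Rightarrow> bool" where
  "one_form X \<A> b \<longleftrightarrow>
     (\<forall>p\<in>topspace X. linear_on_tangent \<A> p (b p)) \<and>
     (\<forall>c\<in>\<A>. \<forall>i. smooth_on (chart_img c) (form_comp \<A> b c i))"

definition pseudo_riemannian_metric ::
    "'a topology \<Rightarrow> ('a, 'n::finite) chart set
      \<Rightarrow> ('a \<Rightarrow> ('a, 'n) tvec \<Rightarrow> ('a, 'n) tvec \<Rightarrow> real) \<Rightarrow> bool" where
  "pseudo_riemannian_metric X \<A> a \<longleftrightarrow>
     (\<forall>p\<in>topspace X.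
        (\<forall>v\<in>tangent_space \<A> p. linear_on_tangent \<A> p (a p v)) \<and>
        (\<forall>v\<in>tangent_space \<A> p. \<forall>w\<in>tangent_space \<A> p. a p v w = a p w v) \<and>
        (\<forall>v\<in>tangent_space \<A> p. (\<forall>w\<in>tangent_space \<A> p. a p v w = 0) \<longrightarrow> v = (\<lambda>_. 0))) \<and>
     (\<forall>c\<in>\<A>. \<forall>i j. smooth_on (chart_img c) (metric_comp \<A> a c i j))"

definition inverse_metric_comp ::
    "('a, 'n::finite) chart set \<Rightarrow> ('a \<Rightarrow> ('a, 'n) tvec \<Rightarrow> ('a, 'n) tvec \<Rightarrow> real)
      \<Rightarrow> ('a, 'n) chart \<Rightarrow> 'n \<Rightarrow> 'n \<Rightarrow> real ^ 'n \<Rightarrow> real" where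
  "inverse_metric_comp \<A> a c i j x = matrix_inv (\<chi> k l. metric_comp \<A> a c k l x) $ i $ j"

definition form_norm_sq ::
    "('a, 'n::finite) chart set \<Rightarrow> ('a \<Rightarrow> ('a, 'n) tvec \<Rightarrow> ('a, 'n) tvec \<Rightarrow> real)
      \<Rightarrow> ('a \<Rightarrow> ('a, 'n) tvec \<Rightarrow> real) \<Rightarrow> ('a, 'n) chart \<Rightarrow> real ^ 'n \<Rightarrow> real" where
  "form_norm_sq \<A> a b c x =
     (\<Sum>i\<in>UNIV. \<Sum>j\<in>UNIV.
        inverse_metric_comp \<A> a c i j x * form_comp \<A> b c i x * form_comp \<A> b c j x)"

definition nowhere_null ::
    "('a, 'n::finite) chart set \<Rightarrow> ('a \<Rightarrow> ('a, 'n) tvec \<Rightarrow> ('a, 'n) tvec \<Rightarrow> real)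
      \<Rightarrow> ('a \<Rightarrow> ('a, 'n) tvec \<Rightarrow> real) \<Rightarrow> bool" where
  "nowhere_null \<A> a b \<longleftrightarrow> (\<forall>c\<in>\<A>. \<forall>x\<in>chart_img c. form_norm_sq \<A> a b c x \<noteq> 0)"

text \<open>\<open>christoffel \<A> g c k i j\<close> is the Christoffel symbol of the Levi-Civita connection of \<open>g\<close> in the
  chart \<open>c\<close>, with upper index \<open>k\<close> and lower indices \<open>i\<close>, \<open>j\<close>.\<close>

definition christoffel ::
    "('a, 'n::finite) chart set \<Rightarrow> ('a \<Rightarrow> ('a, 'n) tvec \<Rightarrow> ('a, 'n) tvec \<Rightarrow> real)
      \<Rightarrow> ('a, 'n) chart \<Rightarrow> 'n \<Rightarrow> 'n \<Rightarrow> 'n \<Rightarrow> real ^ 'n \<Rightarrow> real" where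
  "christoffel \<A> g c k i j x =
     1/2 * (\<Sum>l\<in>UNIV. inverse_metric_comp \<A> g c k l x *
        (dir_deriv (axis i 1) (metric_comp \<A> g c j l) x
         + dir_deriv (axis j 1) (metric_comp \<A> g c i l) x
         - dir_deriv (axis l 1) (metric_comp \<A> g c i j) x))"

definition conic_subbundle ::
    "'a topology \<Rightarrow> ('a, 'n::finite) chart set \<Rightarrow> ('a \<times> ('a, 'n) tvec) set \<Rightarrow> bool" where
  "conic_subbundle X \<A> A \<longleftrightarrow>
     A \<subseteq> tangent_bundle X \<A> \<and>
     (\<forall>c\<in>\<A>. open (local_domain \<A> A c)) \<and>
     (\<forall>(p, v)\<in>A. \<forall>r>0. (p, tvec_scale r v) \<in> A) \<and>
     fst ` A = topspace X"

definition dx :: "'n::finite \<Rightarrow> ((real ^ 'n) \<times> (real ^ 'n) \<Rightarrow> real) \<Rightarrow> (real ^ 'n) \<times> (real ^ 'n) \<Rightarrow> real"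
  where "dx i = dir_deriv (axis i 1, 0)"

definition dy :: "'n::finite \<Rightarrow> ((real ^ 'n) \<times> (real ^ 'n) \<Rightarrow> real) \<Rightarrow> (real ^ 'n) \<times> (real ^ 'n) \<Rightarrow> real"
  where "dy i = dir_deriv (0, axis i 1)"

definition fundamental_tensor ::
    "('a, 'n::finite) chart set \<Rightarrow> ('a \<times> ('a, 'n) tvec \<Rightarrow> real) \<Rightarrow> ('a, 'n) chart
      \<Rightarrow> (real ^ 'n) \<times> (real ^ 'n) \<Rightarrow> real ^ 'n ^ 'n" where
  "fundamental_tensor \<A> F c z = (\<chi> i j. dy i (dy j (\<lambda>u. 1/2 * (local_rep \<A> F c u)\<^sup>2)) z)"

definition finsler_metric ::
    "'a topology \<Rightarrow> ('a, 'n::finite) chart set \<Rightarrow> ('a \<times> ('a, 'n) tvec) set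
      \<Rightarrow> ('a \<times> ('a, 'n) tvec \<Rightarrow> real) \<Rightarrow> bool" where
  "finsler_metric X \<A> A F \<longleftrightarrow>
     conic_subbundle X \<A> A \<and>
     (\<forall>u\<in>A. F u \<ge> 0) \<and>
     (\<forall>c\<in>\<A>. smooth_on (local_domain \<A> A c) (local_rep \<A> F c)) \<and>
     (\<forall>(p, v)\<in>A. \<forall>r>0. F (p, tvec_scale r v) = r * F (p, v)) \<and>
     (\<forall>c\<in>\<A>. \<forall>z\<in>local_domain \<A> A c. invertible (fundamental_tensor \<A> F c z))"

text \<open>\<open>nonlinear_connection \<A> F c j i\<close> is the coefficient \<open>N\<^sup>j\<^sub>i\<close> of the canonical nonlinear
  connection in the chart \<open>c\<close>.\<close>

definition nonlinear_connection ::
    "('a, 'n::finite) chart set \<Rightarrow> ('a \<times> ('a, 'n) tvec \<Rightarrow> real) \<Rightarrow> ('a, 'n) chart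
      \<Rightarrow> 'n \<Rightarrow> 'n \<Rightarrow> (real ^ 'n) \<times> (real ^ 'n) \<Rightarrow> real" where
  "nonlinear_connection \<A> F c j i z =
     (let E = (\<lambda>u. (local_rep \<A> F c u)\<^sup>2) in
      1/4 * dy i (\<lambda>u. \<Sum>k\<in>UNIV. matrix_inv (fundamental_tensor \<A> F c u) $ j $ k *
             ((\<Sum>l\<in>UNIV. snd u $ l * dx l (dy k E) u) - dx k E u)) z)"

text \<open>The functions \<open>\<Gamma>\<close> below, with the same index convention as \<open>christoffel\<close>, are the Christoffel
  symbols of the affine connection of \<open>F\<close>. Their values on the chart images are uniquely determined
  by \<open>F\<close>, since the fibres of \<open>A\<close> are nonempty and open.\<close>

definition affine_connection_of ::
    "('a, 'n::finite) chart set \<Rightarrow> ('a \<times> ('a, 'n) tvec) set \<Rightarrow> ('a \<times> ('a, 'n) tvec \<Rightarrow> real)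
      \<Rightarrow> (('a, 'n) chart \<Rightarrow> 'n \<Rightarrow> 'n \<Rightarrow> 'n \<Rightarrow> real ^ 'n \<Rightarrow> real) \<Rightarrow> bool" where
  "affine_connection_of \<A> A F \<Gamma> \<longleftrightarrow>
     (\<forall>c\<in>\<A>. \<forall>z\<in>local_domain \<A> A c. \<forall>k i.
        nonlinear_connection \<A> F c k i z = (\<Sum>j\<in>UNIV. \<Gamma> c k i j (fst z) * snd z $ j))"

definition berwald ::
    "'a topology \<Rightarrow> ('a, 'n::finite) chart set \<Rightarrow> ('a \<times> ('a, 'n) tvec) set
      \<Rightarrow> ('a \<times> ('a, 'n) tvec \<Rightarrow> real) \<Rightarrow> bool" where
  "berwald X \<A> A F \<longleftrightarrow> finsler_metric X \<A> A F \<and> (\<exists>\<Gamma>. affine_connection_of \<A> A F \<Gamma>)"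

definition metrizable ::
    "'a topology \<Rightarrow> ('a, 'n::finite) chart set \<Rightarrow> ('a \<times> ('a, 'n) tvec) set
      \<Rightarrow> ('a \<times> ('a, 'n) tvec \<Rightarrow> real) \<Rightarrow> bool" where
  "metrizable X \<A> A F \<longleftrightarrow>
     (\<exists>\<Gamma> g. affine_connection_of \<A> A F \<Gamma> \<and> pseudo_riemannian_metric X \<A> g \<and>
        (\<forall>c\<in>\<A>. \<forall>x\<in>chart_img c. \<forall>k i j. \<Gamma> c k i j x = christoffel \<A> g c k i j x))"

text \<open>Powers with a real exponent: a negative base is admitted only for integer exponents and the
  base zero only for positive exponents. \<open>powr\<close> alone would give
  \<open>\<bar>x\<bar> powr r\<close> for negative \<open>x\<close>.\<close>

definition real_power_defined :: "real \<Rightarrow> real \<Rightarrow> bool" where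
  "real_power_defined x r \<longleftrightarrow> x > 0 \<or> (x = 0 \<and> r > 0) \<or> (x < 0 \<and> r \<in> \<int>)"

definition real_power :: "real \<Rightarrow> real \<Rightarrow> real" where
  "real_power x r = (if x < 0 then x powi \<lfloor>r\<rfloor> else x powr r)"

definition kropina_metric ::
    "'a topology \<Rightarrow> ('a, 'n::finite) chart set \<Rightarrow> real
      \<Rightarrow> ('a \<Rightarrow> ('a, 'n) tvec \<Rightarrow> ('a, 'n) tvec \<Rightarrow> real) \<Rightarrow> ('a \<Rightarrow> ('a, 'n) tvec \<Rightarrow> real)
      \<Rightarrow> ('a \<times> ('a, 'n) tvec) set \<Rightarrow> ('a \<times> ('a, 'n) tvec \<Rightarrow> real) \<Rightarrow> bool" where
  "kropina_metric X \<A> m a b A F \<longleftrightarrow>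
     pseudo_riemannian_metric X \<A> a \<and> one_form X \<A> b \<and> finsler_metric X \<A> A F \<and>
     (\<forall>(p, v)\<in>A. let \<alpha> = sqrt \<bar>a p v v\<bar>; \<beta> = b p v in
        real_power_defined \<alpha> (1 + m) \<and> real_power_defined \<beta> (- m) \<and>
        F (p, v) = real_power \<alpha> (1 + m) * real_power \<beta> (- m))"

end

theory Submission
  imports Defs "HOL-Computational_Algebra.Polynomial"
begin

text \<open>Write \<open>E = F\<^sup>2\<close>. Euler's identity and the Euler--Lagrange equation of the spray
  \<open>\<Gamma>\<^sup>j\<^sub>i\<^sub>l y\<^sup>i y\<^sup>l\<close> show that \<open>\<Gamma>\<close> is symmetric and that \<open>E\<close> is horizontally constant,
  \<open>\<partial>\<^sub>k E = \<Gamma>\<^sup>j\<^sub>k\<^sub>l y\<^sup>l \<partial>E/\<partial>y\<^sup>j\<close>. Taking logarithmic derivatives of \<open>E = |a(y,y)| powr (1+m) * |b(y)| powr (-2m)\<close>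
  turns this into the identity of cubic forms \<open>(1+m) b(y) (\<nabla>\<^sub>k a)(y,y) = 2m a(y,y) (\<nabla>\<^sub>k b)(y)\<close>, where \<open>m \<noteq> -1\<close>
  because the fundamental tensor is nondegenerate. As \<open>b\<close> is non-null, \<open>b(y)\<close> does not divide \<open>a(y,y)\<close>,
  so \<open>\<nabla>\<^sub>k a = c\<^sub>k a\<close> and \<open>\<nabla>\<^sub>k b = (1+m)/(2m) c\<^sub>k b\<close>. Then \<open>\<partial>\<^sub>k |b|\<^sup>2 = (c\<^sub>k/m) |b|\<^sup>2\<close>, hence the globally defined
  metric \<open>||b|\<^sup>2| powr (-m) a\<close> is parallel for the torsion-free connection \<open>\<Gamma>\<close>.\<close>

subsection \<open>Calculus of smooth functions\<close>

text \<open>The argument bypasses the criterion for Berwald type by the vector field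
  \<open>f\<close>; in its terms \<open>c\<^sub>k = 2m f\<^sub>k\<close>. The real issue is
  globality. A parallel metric conformal to \<open>a\<close> requires a potential of c, and
  potentials found chart by chart would not have to fit together. Non-nullness supplies one on all
  of M: the weight of |b|^2 is twice that of b minus that of a, namely 2(1+m)/(2m) - 1 = 1/m, so c =
  m d ln ||b|^2| is exact, and -m is the exponent whose logarithmic derivative cancels c. The same
  condition yields the non-divisibility: the hyperplane b(y) = 0 is complementary to the metric dual
  of b, so a nondegenerate a cannot vanish identically on it. One constraint shapes the middle of
  the proof: the formula for E can be differentiated only where a(y,y) and b(y) are nonzero, and y
  ranges only over open fibres. Restriction to lines, where everything is a polynomial in one
  variable, carries the resulting identity to all y.\<close>

lemma dir_deriv_eq:
  assumes "(f has_derivative f') (at z)"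
  shows "dir_deriv v f z = f' v"
  using frechet_derivative_at[OF assms] by (simp add: dir_deriv_def)

lemma has_derivative_dir_deriv:
  assumes "f differentiable (at z)"
  shows "(f has_derivative (\<lambda>v. dir_deriv v f z)) (at z)"
  using assms unfolding dir_deriv_def by (simp add: frechet_derivative_works[symmetric])

lemma linear_dir_deriv:
  assumes "f differentiable (at z)"
  shows "linear (\<lambda>v. dir_deriv v f z)"
  using has_derivative_dir_deriv[OF assms] by (rule has_derivative_linear)

text \<open>Differentiability does not enter: \<open>frechet_derivative\<close> is a choice from the
  set of derivatives, and the two functions have the same set.\<close>

lemma dir_deriv_cong:
  assumes "open S" "z \<in> S" "\<And>x. x \<in> S \<Longrightarrow> f x = g x"
  shows "dir_deriv v f z = dir_deriv v g z"
proof -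
  have "(f has_derivative f') (at z) \<longleftrightarrow> (g has_derivative f') (at z)" for f'
    using has_derivative_transform_within_open[of f f' z UNIV S g]
      has_derivative_transform_within_open[of g f' z UNIV S f] assms by auto
  then show ?thesis by (simp add: dir_deriv_def frechet_derivative_def)
qed

lemma Ck_on_Suc_real:
  fixes f :: "'e::euclidean_space \<Rightarrow> real"
  shows "Ck_on (Suc k) S f \<longleftrightarrow> (\<forall>x\<in>S. f differentiable (at x)) \<and> (\<forall>v. Ck_on k S (dir_deriv v f))"
  by (simp add: dir_deriv_def[abs_def])

declare Ck_on.simps(2) [simp del] Ck_on_Suc_real [simp]

text \<open>The recursion of \<open>Ck_on\<close> constrains only derivatives, so lowering the order
  needs an induction; its base is that differentiability implies continuity.\<close>

lemma Ck_on_SucD: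
  fixes f :: "'e::euclidean_space \<Rightarrow> real"
  shows "Ck_on (Suc k) S f \<Longrightarrow> Ck_on k S f"
proof (induction k arbitrary: f)
  case 0
  then show ?case
    by (auto simp: continuous_on_eq_continuous_within intro: differentiable_imp_continuous_within
        differentiable_at_withinI)
next
  case (Suc k)
  then show ?case
    by (metis Ck_on_Suc_real)
qed

text \<open>Openness passes agreement on \<open>S\<close> to the derivatives. The inductions below
  use this to replace \<open>dir_deriv\<close> by an explicit formula that is valid only on
  \<open>S\<close>.\<close>

lemma Ck_on_cong:
  fixes f g :: "'e::euclidean_space \<Rightarrow> real"
  assumes "open S" "\<And>x. x \<in> S \<Longrightarrow> f x = g x" "Ck_on k S f"
  shows "Ck_on k S g"
  using assms(2,3)
proof (induction k arbitrary: f g)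
  case 0
  then show ?case using continuous_on_cong[of S S f g] by simp
next
  case (Suc k)
  have "g differentiable (at x)" if "x \<in> S" for x
    using Suc.prems that has_derivative_transform_within_open[OF _ assms(1) that, of f _ UNIV g]
    by (simp add: differentiable_def) blast
  moreover have "Ck_on k S (dir_deriv v g)" for v
    using Suc.IH[of "dir_deriv v f" "dir_deriv v g"] Suc.prems dir_deriv_cong[OF assms(1) _ Suc.prems(1)]
    by simp
  ultimately show ?case by simp
qed

lemma Ck_on_const: "Ck_on k S (\<lambda>_. c :: real)"
  by (induction k arbitrary: c) (auto simp: dir_deriv_def[abs_def] frechet_derivative_const)

lemma Ck_on_add:
  fixes f g :: "'e::euclidean_space \<Rightarrow> real"
  assumes "open S" "Ck_on k S f" "Ck_on k S g"
  shows "Ck_on k S (\<lambda>x. f x + g x)"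
  using assms(2,3)
proof (induction k arbitrary: f g)
  case (Suc k)
  have "Ck_on k S (dir_deriv v (\<lambda>x. f x + g x))" for v
  proof (rule Ck_on_cong[OF assms(1), of "\<lambda>x. dir_deriv v f x + dir_deriv v g x"])
    show "Ck_on k S (\<lambda>x. dir_deriv v f x + dir_deriv v g x)"
      using Suc by simp
    show "dir_deriv v f x + dir_deriv v g x = dir_deriv v (\<lambda>x. f x + g x) x" if "x \<in> S" for x
      using Suc.prems that
      by (simp add: dir_deriv_eq[OF has_derivative_add[OF has_derivative_dir_deriv has_derivative_dir_deriv]])
  qed
  then show ?case using Suc.prems by auto
qed (auto intro: continuous_intros)

lemma Ck_on_mult:
  fixes f g :: "'e::euclidean_space \<Rightarrow> real"
  assumes "open S" "Ck_on k S f" "Ck_on k S g"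
  shows "Ck_on k S (\<lambda>x. f x * g x)"
  using assms(2,3)
proof (induction k arbitrary: f g)
  case (Suc k)
  have "Ck_on k S (dir_deriv v (\<lambda>x. f x * g x))" for v
  proof (rule Ck_on_cong[OF assms(1), of "\<lambda>x. f x * dir_deriv v g x + dir_deriv v f x * g x"])
    show "Ck_on k S (\<lambda>x. f x * dir_deriv v g x + dir_deriv v f x * g x)"
      using Suc.prems Suc.prems[THEN Ck_on_SucD] by (intro Ck_on_add[OF assms(1)] Suc.IH) auto
    show "f x * dir_deriv v g x + dir_deriv v f x * g x = dir_deriv v (\<lambda>x. f x * g x) x"
      if "x \<in> S" for x
      using Suc.prems that
      by (simp add: dir_deriv_eq[OF has_derivative_mult[OF has_derivative_dir_deriv has_derivative_dir_deriv]])
  qed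
  then show ?case using Suc.prems by auto
qed (auto intro: continuous_intros)

text \<open>The induction can keep \<open>f\<close> fixed, because the derivative of 1/f is a
  product of 1/f with derivatives of f, all known at the lower order.\<close>

lemma Ck_on_inverse:
  fixes f :: "'e::euclidean_space \<Rightarrow> real"
  assumes "open S" "Ck_on k S f" "\<And>x. x \<in> S \<Longrightarrow> f x \<noteq> 0"
  shows "Ck_on k S (\<lambda>x. inverse (f x))"
  using assms(2)
proof (induction k)
  case (Suc k)
  have IH: "Ck_on k S (\<lambda>x. inverse (f x))" using Suc by (blast intro: Ck_on_SucD)
  have "Ck_on k S (dir_deriv v (\<lambda>x. inverse (f x)))" for v
  proof (rule Ck_on_cong[OF assms(1), of "\<lambda>x. (-1) * (inverse (f x) * dir_deriv v f x * inverse (f x))"])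
    show "Ck_on k S (\<lambda>x. (-1) * (inverse (f x) * dir_deriv v f x * inverse (f x)))"
      using Suc.prems IH by (intro Ck_on_mult[OF assms(1)] Ck_on_const) auto
    show "(-1) * (inverse (f x) * dir_deriv v f x * inverse (f x)) = dir_deriv v (\<lambda>x. inverse (f x)) x"
      if "x \<in> S" for x
      using Suc.prems that assms(3)
      by (simp add: dir_deriv_eq[OF Deriv.has_derivative_inverse[OF _ has_derivative_dir_deriv]])
  qed
  then show ?case using Suc.prems assms(3) by auto
qed (use assms(3) in \<open>auto intro: continuous_intros\<close>)

text \<open>Dividing by the signed value \<open>f x\<close> instead of its absolute value supplies
  the sign of the derivative of the absolute value, so one formula serves both signs.\<close>

lemma has_derivative_abs_powr:
  fixes f :: "'e::real_normed_vector \<Rightarrow> real"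
  assumes "(f has_derivative f') (at x)" "f x \<noteq> 0"
  shows "((\<lambda>x. \<bar>f x\<bar> powr r) has_derivative (\<lambda>v. r * \<bar>f x\<bar> powr r * inverse (f x) * f' v)) (at x)"
proof -
  have "((\<lambda>t. \<bar>t\<bar> powr r) has_real_derivative r * \<bar>f x\<bar> powr r * inverse (f x)) (at (f x))"
  proof (cases "f x > 0")
    case True
    have "((\<lambda>t. t powr r) has_real_derivative r * \<bar>f x\<bar> powr r * inverse (f x)) (at (f x))"
      using True by (auto intro!: derivative_eq_intros simp: powr_diff field_simps)
    then show ?thesis
      by (rule has_field_derivative_transform_within_open[where S="{0<..}"]) (use True in auto)
  next
    case False
    then have n: "f x < 0" using assms(2) by simp
    have "((\<lambda>t. (-t) powr r) has_real_derivative r * \<bar>f x\<bar> powr r * inverse (f x)) (at (f x))"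
      using n by (auto intro!: derivative_eq_intros simp: powr_diff field_simps)
    then show ?thesis
      by (rule has_field_derivative_transform_within_open[where S="{..<0}"]) (use n in auto)
  qed
  from has_derivative_compose[OF assms(1) this[unfolded has_field_derivative_def]]
  show ?thesis by simp
qed

lemma Ck_on_abs_powr:
  fixes f :: "'e::euclidean_space \<Rightarrow> real"
  assumes "open S" "Ck_on k S f" "\<And>x. x \<in> S \<Longrightarrow> f x \<noteq> 0"
  shows "Ck_on k S (\<lambda>x. \<bar>f x\<bar> powr r)"
  using assms(2)
proof (induction k)
  case (Suc k)
  have IH: "Ck_on k S (\<lambda>x. \<bar>f x\<bar> powr r)" using Suc by (blast intro: Ck_on_SucD)
  have der: "((\<lambda>x. \<bar>f x\<bar> powr r) has_derivative
      (\<lambda>v. r * \<bar>f x\<bar> powr r * inverse (f x) * dir_deriv v f x)) (at x)" if "x \<in> S" for x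
    using Suc.prems that assms(3)
    by (intro has_derivative_abs_powr has_derivative_dir_deriv) auto
  have "Ck_on k S (dir_deriv v (\<lambda>x. \<bar>f x\<bar> powr r))" for v
  proof (rule Ck_on_cong[OF assms(1), of "\<lambda>x. r * \<bar>f x\<bar> powr r * inverse (f x) * dir_deriv v f x"])
    show "Ck_on k S (\<lambda>x. r * \<bar>f x\<bar> powr r * inverse (f x) * dir_deriv v f x)"
      using Suc.prems IH Ck_on_SucD[OF Suc.prems] assms(3)
      by (intro Ck_on_mult[OF assms(1)] Ck_on_const Ck_on_inverse[OF assms(1)])
        auto
  qed (simp add: dir_deriv_eq[OF der])
  then show ?case using der by (auto simp: differentiable_def)
qed (use assms(3) in \<open>auto intro!: continuous_intros\<close>)

lemma smooth_on_cong:
  fixes f g :: "'e::euclidean_space \<Rightarrow> real"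
  assumes "open S" "smooth_on S f" "\<And>x. x \<in> S \<Longrightarrow> f x = g x"
  shows "smooth_on S g"
  using assms by (auto simp: smooth_on_def intro: Ck_on_cong)

lemma smooth_on_differentiable:
  "smooth_on S f \<Longrightarrow> x \<in> S \<Longrightarrow> f differentiable (at x)"
  unfolding smooth_on_def using Ck_on.simps(2)[of 0 S f] by blast

lemma smooth_on_has_derivative:
  "smooth_on S f \<Longrightarrow> x \<in> S \<Longrightarrow> (f has_derivative (\<lambda>v. dir_deriv v f x)) (at x)"
  by (intro has_derivative_dir_deriv smooth_on_differentiable)

lemma smooth_on_dir_deriv:
  fixes f :: "'e::euclidean_space \<Rightarrow> real"
  shows "smooth_on S f \<Longrightarrow> smooth_on S (dir_deriv v f)"
  unfolding smooth_on_def using Ck_on_Suc_real by blast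

lemma smooth_on_continuous: "smooth_on S f \<Longrightarrow> continuous_on S f"
  unfolding smooth_on_def using Ck_on.simps(1) by blast

lemma smooth_on_const: "smooth_on S (\<lambda>_. c :: real)"
  by (simp add: smooth_on_def Ck_on_const)

lemma smooth_on_linear:
  fixes f :: "'e::euclidean_space \<Rightarrow> real"
  assumes "bounded_linear f"
  shows "smooth_on S f"
proof -
  have D: "(f has_derivative f) (at x)" for x
    using assms by (rule bounded_linear_imp_has_derivative)
  have "Ck_on (Suc k) S f" for k
    using D by (auto simp: differentiable_def dir_deriv_eq[OF D, abs_def] Ck_on_const)
  then show ?thesis unfolding smooth_on_def by (blast intro: Ck_on_SucD)
qed

context
  fixes S :: "'e::euclidean_space set"
  assumes S: "open S"
begin

lemma smooth_on_add:
  fixes f g :: "'e \<Rightarrow> real"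
  shows "smooth_on S f \<Longrightarrow> smooth_on S g \<Longrightarrow> smooth_on S (\<lambda>x. f x + g x)"
  by (simp add: smooth_on_def Ck_on_add[OF S])

lemma smooth_on_mult:
  fixes f g :: "'e \<Rightarrow> real"
  shows "smooth_on S f \<Longrightarrow> smooth_on S g \<Longrightarrow> smooth_on S (\<lambda>x. f x * g x)"
  by (simp add: smooth_on_def Ck_on_mult[OF S])

lemma smooth_on_minus:
  fixes f :: "'e \<Rightarrow> real"
  shows "smooth_on S f \<Longrightarrow> smooth_on S (\<lambda>x. - f x)"
  using smooth_on_mult[OF smooth_on_const[of S "-1"]] by simp

lemma smooth_on_diff:
  fixes f g :: "'e \<Rightarrow> real"
  shows "smooth_on S f \<Longrightarrow> smooth_on S g \<Longrightarrow> smooth_on S (\<lambda>x. f x - g x)"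
  using smooth_on_add[OF _ smooth_on_minus] by simp

lemma smooth_on_inverse:
  fixes f :: "'e \<Rightarrow> real"
  shows "smooth_on S f \<Longrightarrow> (\<And>x. x \<in> S \<Longrightarrow> f x \<noteq> 0) \<Longrightarrow> smooth_on S (\<lambda>x. inverse (f x))"
  by (simp add: smooth_on_def Ck_on_inverse[OF S])

lemma smooth_on_abs_powr:
  fixes f :: "'e \<Rightarrow> real"
  shows "smooth_on S f \<Longrightarrow> (\<And>x. x \<in> S \<Longrightarrow> f x \<noteq> 0) \<Longrightarrow> smooth_on S (\<lambda>x. \<bar>f x\<bar> powr r)"
  by (simp add: smooth_on_def Ck_on_abs_powr[OF S])

lemma smooth_on_sum:
  fixes f :: "'i \<Rightarrow> 'e \<Rightarrow> real"
  assumes "\<And>i. i \<in> I \<Longrightarrow> smooth_on S (f i)"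
  shows "smooth_on S (\<lambda>x. \<Sum>i\<in>I. f i x)"
  using assms by (induction I rule: infinite_finite_induct) (auto intro: smooth_on_add smooth_on_const)

lemma smooth_on_prod:
  fixes f :: "'i \<Rightarrow> 'e \<Rightarrow> real"
  assumes "\<And>i. i \<in> I \<Longrightarrow> smooth_on S (f i)"
  shows "smooth_on S (\<lambda>x. \<Prod>i\<in>I. f i x)"
  using assms by (induction I rule: infinite_finite_induct) (auto intro: smooth_on_mult smooth_on_const)

lemma smooth_on_det:
  fixes M :: "'e \<Rightarrow> real^'n^'n"
  assumes "\<And>i j. smooth_on S (\<lambda>x. M x $ i $ j)"
  shows "smooth_on S (\<lambda>x. det (M x))"
  unfolding det_def
  by (intro smooth_on_sum smooth_on_mult smooth_on_prod smooth_on_const assms)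

end

section \<open>Smoothness of the inverse matrix\<close>

lemma matrix_inv_right_left:
  fixes M :: "real^'n^'n"
  assumes "invertible M"
  shows "M ** matrix_inv M = mat 1" "matrix_inv M ** M = mat 1"
  using someI_ex[of "\<lambda>A'. M ** A' = mat 1 \<and> A' ** M = mat 1"] assms
  by (auto simp: invertible_def matrix_inv_def)

text \<open>Cramer's rule for the system with right-hand side \<open>axis j 1\<close>, whose
  solution is column j of the inverse. It makes the entries rational functions of those of
  \<open>M\<close>, which is what smoothness needs.\<close>

lemma matrix_inv_nth:
  fixes M :: "real^'n^'n"
  assumes "invertible M"
  shows "matrix_inv M $ i $ j = det (\<chi> p q. if q = i then axis j 1 $ p else M $ p $ q) * inverse (det M)"
proof -
  have "M *v (matrix_inv M *v axis j 1) = axis j 1"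
    by (simp add: matrix_vector_mul_assoc matrix_inv_right_left[OF assms])
  then have "matrix_inv M *v axis j 1 = (\<chi> k. det(\<chi> p q. if q = k then axis j 1 $ p else M$p$q) / det M)"
    using cramer[of M] assms by (simp add: invertible_det_nz)
  moreover have "matrix_inv M $ i $ j = (matrix_inv M *v axis j 1) $ i"
    by (simp add: matrix_vector_mul_component inner_axis)
  ultimately show ?thesis by (simp add: divide_inverse)
qed

lemma smooth_on_matrix_inv:
  fixes M :: "'e::euclidean_space \<Rightarrow> real^'n^'n"
  assumes S: "open S" and M: "\<And>i j. smooth_on S (\<lambda>x. M x $ i $ j)"
    and inv: "\<And>x. x \<in> S \<Longrightarrow> invertible (M x)"
  shows "smooth_on S (\<lambda>x. matrix_inv (M x) $ i $ j)"
proof (rule smooth_on_cong[OF S])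
  have "smooth_on S (\<lambda>x. (\<chi> p q. if q = i then axis j 1 $ p else M x $ p $ q) $ k $ l)" for k l
    by (cases "l = i") (simp_all add: M smooth_on_const)
  then show "smooth_on S (\<lambda>x. det (\<chi> p q. if q = i then axis j 1 $ p else M x $ p $ q) * inverse (det (M x)))"
    using inv by (intro smooth_on_mult[OF S] smooth_on_inverse[OF S] smooth_on_det[OF S] M)
      (auto simp: invertible_det_nz)
qed (simp add: matrix_inv_nth inv)

subsection \<open>Symmetry of second derivatives and Euler's identity\<close>

lemma has_real_derivative_line:
  fixes f :: "'e::euclidean_space \<Rightarrow> real"
  assumes "f differentiable (at (z + t *\<^sub>R v))"
  shows "((\<lambda>s. f (z + s *\<^sub>R v)) has_real_derivative dir_deriv v f (z + t *\<^sub>R v)) (at t)"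
proof -
  have "((\<lambda>s. z + s *\<^sub>R v) has_derivative (\<lambda>h. h *\<^sub>R v)) (at t)"
    by (auto intro!: derivative_eq_intros)
  from has_derivative_compose[OF this has_derivative_dir_deriv[OF assms]]
  have "((\<lambda>s. f (z + s *\<^sub>R v)) has_derivative (\<lambda>h. dir_deriv (h *\<^sub>R v) f (z + t *\<^sub>R v))) (at t)" .
  then show ?thesis
    by (rule has_derivative_imp_has_field_derivative)
      (simp add: linear_cmul[OF linear_dir_deriv[OF assms]])
qed

text \<open>Two applications of the mean value theorem: along \<open>u\<close> to the difference of
  \<open>f\<close> on two opposite sides of the parallelogram, then along \<open>v\<close> to
  \<open>dir_deriv u f\<close>.\<close>

lemma second_difference_mean_value:
  fixes f :: "'e::euclidean_space \<Rightarrow> real"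
  assumes f: "smooth_on S f" and t: "t > 0"
    and sq: "\<And>p q. 0 \<le> p \<Longrightarrow> p \<le> t \<Longrightarrow> 0 \<le> q \<Longrightarrow> q \<le> t \<Longrightarrow> z + p *\<^sub>R u + q *\<^sub>R v \<in> S"
  obtains p q where "0 < p" "p < t" "0 < q" "q < t"
    "f (z + t *\<^sub>R u + t *\<^sub>R v) - f (z + t *\<^sub>R u) - f (z + t *\<^sub>R v) + f z
      = t\<^sup>2 * dir_deriv v (dir_deriv u f) (z + p *\<^sub>R u + q *\<^sub>R v)"
proof -
  have d: "((\<lambda>p. f (z + c *\<^sub>R v + p *\<^sub>R u)) has_real_derivative dir_deriv u f (z + c *\<^sub>R v + p *\<^sub>R u)) (at p)"
    if "0 \<le> p" "p \<le> t" "0 \<le> c" "c \<le> t" for p c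
    using sq[of p c] that
    by (intro has_real_derivative_line smooth_on_differentiable[OF f]) (simp add: add_ac)
  have "\<exists>p>0. p < t \<and> (f (z + t *\<^sub>R v + t *\<^sub>R u) - f (z + 0 *\<^sub>R v + t *\<^sub>R u))
      - (f (z + t *\<^sub>R v + 0 *\<^sub>R u) - f (z + 0 *\<^sub>R v + 0 *\<^sub>R u))
      = (t - 0) * (dir_deriv u f (z + t *\<^sub>R v + p *\<^sub>R u) - dir_deriv u f (z + 0 *\<^sub>R v + p *\<^sub>R u))"
    by (rule MVT2[OF t]) (intro DERIV_diff d; use t in simp)
  then obtain p where p: "0 < p" "p < t" and
    1: "f (z + t *\<^sub>R u + t *\<^sub>R v) - f (z + t *\<^sub>R u) - f (z + t *\<^sub>R v) + f z
      = t * (dir_deriv u f (z + p *\<^sub>R u + t *\<^sub>R v) - dir_deriv u f (z + p *\<^sub>R u + 0 *\<^sub>R v))"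
    by (auto simp: algebra_simps)
  have "\<exists>q>0. q < t \<and> dir_deriv u f (z + p *\<^sub>R u + t *\<^sub>R v) - dir_deriv u f (z + p *\<^sub>R u + 0 *\<^sub>R v)
      = (t - 0) * dir_deriv v (dir_deriv u f) (z + p *\<^sub>R u + q *\<^sub>R v)"
    using p sq by (intro MVT2[OF t] has_real_derivative_line smooth_on_differentiable[OF smooth_on_dir_deriv[OF f]]) simp
  then show thesis using 1 p that by (auto simp: power2_eq_square)
qed

text \<open>The second difference is symmetric in \<open>u\<close> and \<open>v\<close>, so the two
  mixed derivatives agree at some pair of points of each small parallelogram. By continuity they
  cannot differ at the corner \<open>z\<close>.\<close>

lemma dir_deriv_commute:
  fixes f :: "'e::euclidean_space \<Rightarrow> real"
  assumes S: "open S" and f: "smooth_on S f" and z: "z \<in> S"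
  shows "dir_deriv u (dir_deriv v f) z = dir_deriv v (dir_deriv u f) z"
proof (rule ccontr)
  let ?a = "dir_deriv u (dir_deriv v f)" and ?b = "dir_deriv v (dir_deriv u f)"
  assume ne: "?a z \<noteq> ?b z"
  \<comment> \<open>Half the gap, so that the intervals of radius \<open>e\<close> around the two
    values are disjoint.\<close>
  define e where "e = \<bar>?a z - ?b z\<bar> / 2"
  have e: "e > 0" using ne by (simp add: e_def)
  have "continuous_on S ?a" "continuous_on S ?b"
    by (intro smooth_on_continuous smooth_on_dir_deriv f)+
  then have "\<forall>\<^sub>F w in nhds z. \<bar>?a w - ?a z\<bar> < e" "\<forall>\<^sub>F w in nhds z. \<bar>?b w - ?b z\<bar> < e"
    using S z e
    by (auto simp: continuous_on_eq_continuous_at isCont_def tendsto_at_iff_tendsto_nhds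
        dist_real_def dest!: tendstoD[of _ _ _ e])
  moreover have "\<forall>\<^sub>F w in nhds z. w \<in> S" using S z by (rule eventually_nhds_in_open)
  ultimately have "\<forall>\<^sub>F w in nhds z. w \<in> S \<and> \<bar>?a w - ?a z\<bar> < e \<and> \<bar>?b w - ?b z\<bar> < e"
    by eventually_elim auto
  then obtain d where d: "d > 0"
    and near: "\<And>w. dist w z < d \<Longrightarrow> w \<in> S \<and> \<bar>?a w - ?a z\<bar> < e \<and> \<bar>?b w - ?b z\<bar> < e"
    by (auto simp: eventually_nhds_metric)
  \<comment> \<open>This side length keeps the whole parallelogram within distance \<open>d\<close>
    of \<open>z\<close>; the summand 1 covers the case that both directions vanish.\<close>
  define t where "t = d / (norm u + norm v + 1)"
  have N: "norm u + norm v + 1 > 0" by (smt (verit) norm_ge_zero)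
  have t: "t > 0" using d N by (simp add: t_def)
  have sq: "dist (z + p *\<^sub>R u + q *\<^sub>R v) z < d" if "0 \<le> p" "p \<le> t" "0 \<le> q" "q \<le> t" for p q
  proof -
    have "dist (z + p *\<^sub>R u + q *\<^sub>R v) z \<le> norm (p *\<^sub>R u) + norm (q *\<^sub>R v)"
      using norm_triangle_ineq[of "p *\<^sub>R u" "q *\<^sub>R v"] by (simp add: dist_norm)
    also have "\<dots> \<le> t * norm u + t * norm v"
      using that by (auto intro!: add_mono mult_right_mono)
    also have "\<dots> < t * (norm u + norm v + 1)" using t by (simp add: algebra_simps)
    also have "\<dots> = d" using N by (simp add: t_def)
    finally show ?thesis .
  qed
  have sqS: "z + p *\<^sub>R u + q *\<^sub>R v \<in> S" "z + p *\<^sub>R v + q *\<^sub>R u \<in> S"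
    if "0 \<le> p" "p \<le> t" "0 \<le> q" "q \<le> t" for p q
    using near[OF sq[of p q]] near[OF sq[of q p]] that by (simp_all add: add_ac)
  obtain p q where 1: "0 < p" "p < t" "0 < q" "q < t"
    "f (z + t *\<^sub>R u + t *\<^sub>R v) - f (z + t *\<^sub>R u) - f (z + t *\<^sub>R v) + f z
      = t\<^sup>2 * ?b (z + p *\<^sub>R u + q *\<^sub>R v)"
    using second_difference_mean_value[OF f t sqS(1)] by blast
  obtain p' q' where 2: "0 < p'" "p' < t" "0 < q'" "q' < t"
    "f (z + t *\<^sub>R v + t *\<^sub>R u) - f (z + t *\<^sub>R v) - f (z + t *\<^sub>R u) + f z
      = t\<^sup>2 * ?a (z + q' *\<^sub>R v + p' *\<^sub>R u)"
    using second_difference_mean_value[OF f t sqS(2)] by blast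
  have "t\<^sup>2 * ?b (z + p *\<^sub>R u + q *\<^sub>R v) = t\<^sup>2 * ?a (z + p' *\<^sub>R u + q' *\<^sub>R v)"
    using 1(5) 2(5) by (simp add: add_ac) (simp add: algebra_simps)
  then have "?b (z + p *\<^sub>R u + q *\<^sub>R v) = ?a (z + p' *\<^sub>R u + q' *\<^sub>R v)"
    using t by simp
  moreover have "\<bar>?b (z + p *\<^sub>R u + q *\<^sub>R v) - ?b z\<bar> < e"
    using near[OF sq, of p q] 1 by simp
  moreover have "\<bar>?a (z + p' *\<^sub>R u + q' *\<^sub>R v) - ?a z\<bar> < e"
    using near[OF sq, of p' q'] 2 by simp
  ultimately show False unfolding e_def by (simp add: abs_if split: if_splits)
qed

section \<open>Homogeneous functions on conic fibres\<close>

definition fibre_cone :: "((real^'n) \<times> (real^'n)) set \<Rightarrow> bool" where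
  "fibre_cone D \<longleftrightarrow> (\<forall>x y r. (x, y) \<in> D \<longrightarrow> r > 0 \<longrightarrow> (x, r *\<^sub>R y) \<in> D)"

definition fibre_homogeneous :: "((real^'n) \<times> (real^'n)) set \<Rightarrow> nat \<Rightarrow> ((real^'n) \<times> (real^'n) \<Rightarrow> real) \<Rightarrow> bool" where
  "fibre_homogeneous D p f \<longleftrightarrow> (\<forall>x y r. (x, y) \<in> D \<longrightarrow> r > 0 \<longrightarrow> f (x, r *\<^sub>R y) = r ^ p * f (x, y))"

lemma dir_deriv_fibre_scale:
  fixes f :: "(real^'n) \<times> (real^'n) \<Rightarrow> real"
  assumes D: "open D" "fibre_cone D" and f: "smooth_on D f" "fibre_homogeneous D p f"
    and z: "(x, y) \<in> D" and r: "r > 0"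
  shows "dir_deriv (v, r *\<^sub>R w) f (x, r *\<^sub>R y) = r ^ p * dir_deriv (v, w) f (x, y)"
proof -
  let ?h = "\<lambda>u. f (fst u, r *\<^sub>R snd u)"
  have z': "(x, r *\<^sub>R y) \<in> D" using D z r by (simp add: fibre_cone_def)
  have "((\<lambda>u. (fst u, r *\<^sub>R snd u)) has_derivative (\<lambda>u. (fst u, r *\<^sub>R snd u))) (at (x, y))"
    by (auto intro!: derivative_eq_intros)
  from has_derivative_compose[OF this, of f "\<lambda>v. dir_deriv v f (x, r *\<^sub>R y)"]
  have 1: "(?h has_derivative (\<lambda>u. dir_deriv (fst u, r *\<^sub>R snd u) f (x, r *\<^sub>R y))) (at (x, y))"
    using smooth_on_has_derivative[OF f(1) z'] by simp
  have "((\<lambda>u. r ^ p * f u) has_derivative (\<lambda>u. r ^ p * dir_deriv u f (x, y))) (at (x, y))"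
    by (intro has_derivative_mult_right smooth_on_has_derivative[OF f(1) z])
  then have 2: "(?h has_derivative (\<lambda>u. r ^ p * dir_deriv u f (x, y))) (at (x, y))"
    by (rule has_derivative_transform_within_open[OF _ D(1) z])
      (use f(2) r in \<open>auto simp: fibre_homogeneous_def\<close>)
  show ?thesis
    using dir_deriv_eq[OF 1, of "(v, w)"] dir_deriv_eq[OF 2, of "(v, w)"] by simp
qed

lemma fibre_homogeneous_dx:
  assumes "open D" "fibre_cone D" "smooth_on D f" "fibre_homogeneous D p f"
  shows "fibre_homogeneous D p (dx i f)"
  using dir_deriv_fibre_scale[OF assms, of _ _ _ _ 0]
  by (simp add: fibre_homogeneous_def dx_def)

lemma fibre_homogeneous_dy:
  assumes "open D" "fibre_cone D" "smooth_on D f" "fibre_homogeneous D (Suc p) f"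
  shows "fibre_homogeneous D p (dy i f)"
  unfolding fibre_homogeneous_def
proof (intro allI impI)
  fix x y :: "real^'a" and r :: real
  assume z: "(x, y) \<in> D" and r: "r > 0"
  then have z': "(x, r *\<^sub>R y) \<in> D" using assms(2) by (simp add: fibre_cone_def)
  \<comment> \<open>Pulling \<open>r\<close> out of the direction leaves one power fewer on the
    other side.\<close>
  have "dir_deriv (0, r *\<^sub>R axis i 1) f (x, r *\<^sub>R y) = r * dy i f (x, r *\<^sub>R y)"
    using linear_cmul[OF linear_dir_deriv[OF smooth_on_differentiable[OF assms(3) z']], of r "(0, axis i 1)"]
    by (simp add: dy_def)
  then show "dy i f (x, r *\<^sub>R y) = r ^ p * dy i f (x, y)"
    using dir_deriv_fibre_scale[OF assms z r, of 0 "axis i 1"] r by (simp add: dy_def)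
qed

lemma dir_deriv_sum_axis:
  fixes f :: "(real^'n) \<times> (real^'n) \<Rightarrow> real"
  assumes "f differentiable (at z)"
  shows "dir_deriv (w, 0) f z = (\<Sum>i\<in>UNIV. w $ i * dx i f z)"
    and "dir_deriv (0, w) f z = (\<Sum>i\<in>UNIV. w $ i * dy i f z)"
proof -
  have w: "w = (\<Sum>i\<in>UNIV. w $ i *\<^sub>R axis i 1)"
    by (simp add: vec_eq_iff axis_def if_distrib cong: if_cong)
  have s: "(\<Sum>i\<in>UNIV. (h i, 0)) = (sum h UNIV, 0)" "(\<Sum>i\<in>UNIV. (0, h i)) = (0, sum h UNIV)"
    for h :: "'n \<Rightarrow> real^'n"
    by (simp_all add: sum_prod)
  have "(w, 0) = (\<Sum>i\<in>UNIV. w $ i *\<^sub>R (axis i 1 :: real^'n, 0 :: real^'n))"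
    "(0, w) = (\<Sum>i\<in>UNIV. w $ i *\<^sub>R (0 :: real^'n, axis i 1 :: real^'n))"
    using w by (simp_all add: s)
  moreover have "dir_deriv (\<Sum>i\<in>UNIV. w $ i *\<^sub>R e i) f z = (\<Sum>i\<in>UNIV. w $ i * dir_deriv (e i) f z)" for e
    by (simp add: linear_sum[OF linear_dir_deriv[OF assms]] linear_cmul[OF linear_dir_deriv[OF assms]])
  ultimately show "dir_deriv (w, 0) f z = (\<Sum>i\<in>UNIV. w $ i * dx i f z)"
    "dir_deriv (0, w) f z = (\<Sum>i\<in>UNIV. w $ i * dy i f z)"
    by (simp_all add: dx_def dy_def del: scaleR_Pair)
qed

text \<open>Differentiate f(x, s y) = s^p f(x, y) in s at s = 1.\<close>

lemma euler_identity:
  assumes D: "open D" "fibre_cone D" and f: "smooth_on D f" "fibre_homogeneous D p f"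
    and z: "(x, y) \<in> D"
  shows "(\<Sum>i\<in>UNIV. y $ i * dy i f (x, y)) = p * f (x, y)"
proof -
  have dz: "f differentiable (at (x, y))" by (rule smooth_on_differentiable[OF f(1) z])
  have "((\<lambda>s. f ((x, 0) + s *\<^sub>R (0, y))) has_real_derivative dir_deriv (0, y) f ((x, 0) + 1 *\<^sub>R (0, y))) (at 1)"
    by (rule has_real_derivative_line) (simp add: dz)
  moreover have "((\<lambda>s. f ((x, 0) + s *\<^sub>R (0, y))) has_real_derivative p * f (x, y)) (at 1)"
  proof (rule has_field_derivative_transform_within_open[where S="{0<..}"])
    show "((\<lambda>s. s ^ p * f (x, y)) has_real_derivative p * f (x, y)) (at 1)"
      by (auto intro!: derivative_eq_intros)
  qed (use f(2) z in \<open>auto simp: fibre_homogeneous_def\<close>)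
  ultimately have "dir_deriv (0, y) f (x, y) = p * f (x, y)"
    by (auto dest: DERIV_unique)
  then show ?thesis using dir_deriv_sum_axis(2)[OF dz, of y] by simp
qed

subsection \<open>The spray of a homogeneous energy function\<close>

lemma open_line:
  fixes y v :: "'a::real_normed_vector"
  assumes "open V" "y \<in> V"
  obtains e :: real where "e > 0" "\<And>t. \<bar>t\<bar> < e \<Longrightarrow> y + t *\<^sub>R v \<in> V"
proof -
  have "open ((\<lambda>t::real. y + t *\<^sub>R v) -` V)"
    by (intro open_vimage assms continuous_intros)
  moreover have "0 \<in> (\<lambda>t::real. y + t *\<^sub>R v) -` V" using assms by simp
  ultimately have "\<exists>e>0. \<forall>t. \<bar>t - 0\<bar> < e \<longrightarrow> t \<in> (\<lambda>t::real. y + t *\<^sub>R v) -` V"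
    unfolding open_real by blast
  then show thesis using that by auto
qed

lemma sum_mult_swap:
  fixes a c :: "'i \<Rightarrow> real"
  shows "(\<Sum>j\<in>I. a j * (\<Sum>k\<in>J. c k * m k j)) = (\<Sum>k\<in>J. c k * (\<Sum>j\<in>I. a j * m k j))"
  unfolding sum_distrib_left by (subst sum.swap) (simp add: mult.left_commute)

text \<open>The analysis inside a single chart: \<open>E\<close> stands for the squared Finsler
  function, \<open>H\<close> for its fundamental tensor, and \<open>connection\<close> is the
  Berwald condition with the nonlinear connection written out.\<close>

locale berwald_energy =
  fixes D :: "((real^'n::finite) \<times> (real^'n)) set"
    and E :: "(real^'n) \<times> (real^'n) \<Rightarrow> real"
    and \<Gamma> :: "'n \<Rightarrow> 'n \<Rightarrow> 'n \<Rightarrow> real^'n \<Rightarrow> real"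
    and H :: "(real^'n) \<times> (real^'n) \<Rightarrow> real^'n^'n"
  assumes D: "open D" "fibre_cone D"
    and E: "smooth_on D E" "fibre_homogeneous D 2 E"
    and H_def: "H = (\<lambda>z. \<chi> i j. dy i (dy j (\<lambda>u. 1/2 * E u)) z)"
    and H_inv: "\<And>z. z \<in> D \<Longrightarrow> invertible (H z)"
    and connection: "\<And>z j i. z \<in> D \<Longrightarrow>
      1/4 * dy i (\<lambda>u. \<Sum>k\<in>UNIV. matrix_inv (H u) $ j $ k *
             ((\<Sum>l\<in>UNIV. snd u $ l * dx l (dy k E) u) - dx k E u)) z
        = (\<Sum>l\<in>UNIV. \<Gamma> j i l (fst z) * snd z $ l)"
begin

text \<open>The Euler-Lagrange covector of the energy, up to the acceleration term.\<close>

definition q :: "'n \<Rightarrow> (real^'n) \<times> (real^'n) \<Rightarrow> real" where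
  "q k u = (\<Sum>l\<in>UNIV. snd u $ l * dx l (dy k E) u) - dx k E u"

text \<open>Four times the usual spray coefficient, so that its fibre derivative is four times the
  nonlinear connection.\<close>

definition K :: "'n \<Rightarrow> (real^'n) \<times> (real^'n) \<Rightarrow> real" where
  "K j u = (\<Sum>k\<in>UNIV. matrix_inv (H u) $ j $ k * q k u)"

lemma smooth_dx: "smooth_on D f \<Longrightarrow> smooth_on D (dx i f)"
  and smooth_dy: "smooth_on D f \<Longrightarrow> smooth_on D (dy i f)"
  by (simp_all add: dx_def dy_def smooth_on_dir_deriv)

lemma smooth_half_E: "smooth_on D (\<lambda>u. 1/2 * E u)"
  by (intro smooth_on_mult D smooth_on_const E)

lemma smooth_K: "smooth_on D (K j)"
proof -
  have "bounded_linear (\<lambda>u :: (real^'n) \<times> (real^'n). snd u $ l)" for l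
    by (rule bounded_linear_compose[OF bounded_linear_vec_nth bounded_linear_snd])
  then have "smooth_on D (q k)" for k
    unfolding q_def[abs_def]
    by (intro smooth_on_diff smooth_on_sum smooth_on_mult D smooth_dx smooth_dy E smooth_on_linear)
  moreover have "smooth_on D (\<lambda>u. matrix_inv (H u) $ i $ j)" for i j
    by (rule smooth_on_matrix_inv[OF D(1) _ H_inv])
      (use smooth_dy[OF smooth_dy[OF smooth_half_E]] in \<open>simp add: H_def\<close>)
  ultimately show ?thesis
    unfolding K_def[abs_def] by (intro smooth_on_sum smooth_on_mult D)
qed

lemma homogeneous_K: "fibre_homogeneous D 2 (K j)"
proof -
  have "fibre_homogeneous D 2 (\<lambda>u. 1/2 * E u)"
    using E(2) by (simp add: fibre_homogeneous_def)
  then have "fibre_homogeneous D 0 (dy i (dy j (\<lambda>u. 1/2 * E u)))" for i j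
    by (intro fibre_homogeneous_dy D smooth_dy smooth_half_E) (simp add: numeral_2_eq_2)
  then have HH: "H (x, r *\<^sub>R y) = H (x, y)" if "(x, y) \<in> D" "r > 0" for x y r
    using that by (simp add: H_def fibre_homogeneous_def vec_eq_iff)
  have "fibre_homogeneous D 1 (dx l (dy k E))" for k l
    using E(2) by (intro fibre_homogeneous_dx fibre_homogeneous_dy D smooth_dy E) (simp add: numeral_2_eq_2)
  moreover have "fibre_homogeneous D 2 (dx k E)" for k
    by (intro fibre_homogeneous_dx D E)
  ultimately have "q k (x, r *\<^sub>R y) = r\<^sup>2 * q k (x, y)" if "(x, y) \<in> D" "r > 0" for x y k r
    using that
    by (simp add: q_def fibre_homogeneous_def right_diff_distrib sum_distrib_left power2_eq_square mult_ac)
  then show ?thesis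
    by (simp add: fibre_homogeneous_def K_def HH sum_distrib_left mult_ac)
qed

lemma dy_K: "z \<in> D \<Longrightarrow> dy i (K j) z = 4 * (\<Sum>l\<in>UNIV. \<Gamma> j i l (fst z) * snd z $ l)"
  using connection[of z i j] unfolding K_def[abs_def] q_def[abs_def] by simp

text \<open>The Berwald condition determines only the fibre derivatives of \<open>K\<close>; Euler's
  identity in degree 2 recovers \<open>K\<close> itself.\<close>

lemma K_eq:
  assumes "(x, y) \<in> D"
  shows "K j (x, y) = 2 * (\<Sum>i\<in>UNIV. \<Sum>l\<in>UNIV. \<Gamma> j i l x * y $ i * y $ l)"
proof -
  have "2 * K j (x, y) = (\<Sum>i\<in>UNIV. y $ i * dy i (K j) (x, y))"
    using euler_identity[OF D smooth_K homogeneous_K assms, of j] by simp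
  also have "\<dots> = (\<Sum>i\<in>UNIV. \<Sum>l\<in>UNIV. 4 * (\<Gamma> j i l x * y $ i * y $ l))"
    by (simp add: dy_K assms sum_distrib_left mult_ac)
  finally show ?thesis by (simp add: sum_distrib_left[symmetric])
qed

lemma line_in_D:
  assumes "(x, y) \<in> D"
  obtains e where "e > 0" "\<And>t. \<bar>t\<bar> < e \<Longrightarrow> (x, y + t *\<^sub>R w) \<in> D"
proof -
  obtain e where "e > 0" "\<And>t. \<bar>t\<bar> < e \<Longrightarrow> (x, y) + t *\<^sub>R (0, w) \<in> D"
    using open_line[OF D(1) assms] by blast
  then show thesis using that by simp
qed

lemma has_real_derivative_fibre:
  assumes "smooth_on D f" "(x, y) \<in> D"
  shows "((\<lambda>t. f (x, y + t *\<^sub>R axis i 1)) has_real_derivative dy i f (x, y)) (at 0)"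
  using has_real_derivative_line[of f "(x, y)" 0 "(0, axis i 1)"] smooth_on_differentiable[OF assms]
  by (simp add: dy_def)

text \<open>Allows an identity known only on \<open>D\<close> to be differentiated along a fibre:
  openness keeps a short segment of the line inside \<open>D\<close>.\<close>

lemma transform_fibre:
  assumes "((\<lambda>t. f (x, y + t *\<^sub>R w)) has_real_derivative d) (at 0)" "(x, y) \<in> D"
    and "\<And>y. (x, y) \<in> D \<Longrightarrow> f (x, y) = g y"
  shows "((\<lambda>t. g (y + t *\<^sub>R w)) has_real_derivative d) (at 0)"
proof -
  obtain e where "e > 0" "\<And>t. \<bar>t\<bar> < e \<Longrightarrow> (x, y + t *\<^sub>R w) \<in> D"
    using line_in_D[OF assms(2)] by blast
  then show ?thesis
    using assms(3) by (intro has_field_derivative_transform_within[OF assms(1), of e]) (auto simp: dist_real_def)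
qed

text \<open>The two contractions stay separate because this derivative is what the symmetry of
  \<open>\<Gamma>\<close> is deduced from.\<close>

lemma quadratic_has_derivative:
  "((\<lambda>t. \<Sum>p\<in>UNIV. \<Sum>l\<in>UNIV. \<Gamma> j p l x * (y + t *\<^sub>R axis i 1) $ p * (y + t *\<^sub>R axis i 1) $ l)
    has_real_derivative (\<Sum>l\<in>UNIV. \<Gamma> j i l x * y $ l) + (\<Sum>l\<in>UNIV. \<Gamma> j l i x * y $ l)) (at 0)"
proof -
  have e: "((\<lambda>t. (y + t *\<^sub>R axis i 1) $ l) has_real_derivative (if l = i then 1 else 0)) (at 0)" for l
    by (auto simp: axis_def intro!: derivative_eq_intros)
  have "((\<lambda>t. \<Sum>p\<in>UNIV. \<Sum>l\<in>UNIV. \<Gamma> j p l x * ((y + t *\<^sub>R axis i 1) $ p * (y + t *\<^sub>R axis i 1) $ l))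
    has_real_derivative (\<Sum>p\<in>UNIV. \<Sum>l\<in>UNIV. \<Gamma> j p l x *
      ((if p = i then 1 else 0) * (y + 0 *\<^sub>R axis i 1) $ l + (if l = i then 1 else 0) * (y + 0 *\<^sub>R axis i 1) $ p))) (at 0)"
    by (intro DERIV_sum DERIV_cmult DERIV_mult e)
  moreover have "(\<Sum>p\<in>UNIV. \<Sum>l\<in>UNIV. \<Gamma> j p l x *
      ((if p = i then 1 else 0) * (y + 0 *\<^sub>R axis i 1) $ l + (if l = i then 1 else 0) * (y + 0 *\<^sub>R axis i 1) $ p))
    = (\<Sum>l\<in>UNIV. \<Gamma> j i l x * y $ l) + (\<Sum>l\<in>UNIV. \<Gamma> j l i x * y $ l)"
  proof -
    have "(\<Sum>p\<in>UNIV. \<Sum>l\<in>UNIV. (if p = i then \<Gamma> j p l x * y $ l else 0))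
       = (\<Sum>p\<in>UNIV. if p = i then (\<Sum>l\<in>UNIV. \<Gamma> j p l x * y $ l) else 0)"
      by (intro sum.cong) auto
    moreover have "(\<Sum>p\<in>UNIV. \<Sum>l\<in>UNIV. \<Gamma> j p l x *
      ((if p = i then 1 else 0) * (y + 0 *\<^sub>R axis i 1) $ l + (if l = i then 1 else 0) * (y + 0 *\<^sub>R axis i 1) $ p))
      = (\<Sum>p\<in>UNIV. \<Sum>l\<in>UNIV. (if p = i then \<Gamma> j p l x * y $ l else 0) + (if l = i then \<Gamma> j p l x * y $ p else 0))"
      by (intro sum.cong) auto
    ultimately show ?thesis by (simp add: sum.distrib)
  qed
  ultimately show ?thesis by (simp add: mult.assoc)
qed

text \<open>Differentiating the quadratic expression \<open>K_eq\<close> gives the symmetrized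
  symbols, whereas \<open>dy_K\<close> gives the original ones. So the antisymmetric part contracts
  to zero with every y of an open fibre.\<close>

lemma connection_symmetric:
  assumes "(x, y) \<in> D"
  shows "\<Gamma> j i l x = \<Gamma> j l i x"
proof -
  have eq: "(\<Sum>l\<in>UNIV. (\<Gamma> j i l x - \<Gamma> j l i x) * y $ l) = 0" if y: "(x, y) \<in> D" for y
  proof -
    have "((\<lambda>t. 2 * (\<Sum>p\<in>UNIV. \<Sum>l\<in>UNIV. \<Gamma> j p l x * (y + t *\<^sub>R axis i 1) $ p * (y + t *\<^sub>R axis i 1) $ l))
      has_real_derivative dy i (K j) (x, y)) (at 0)"
      by (rule transform_fibre[OF has_real_derivative_fibre[OF smooth_K y] y K_eq])
    moreover note DERIV_cmult[OF quadratic_has_derivative[of j x y i], of 2]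
    ultimately have "dy i (K j) (x, y) = 2 * ((\<Sum>l\<in>UNIV. \<Gamma> j i l x * y $ l) + (\<Sum>l\<in>UNIV. \<Gamma> j l i x * y $ l))"
      by (rule DERIV_unique)
    then show ?thesis using dy_K[OF y, of i j] by (simp add: left_diff_distrib sum_subtractf)
  qed
  obtain e where "e > 0" and e: "\<And>t. \<bar>t\<bar> < e \<Longrightarrow> (x, y + t *\<^sub>R axis l 1) \<in> D"
    using line_in_D[OF assms] by blast
  \<comment> \<open>Two points of the fibre that differ by a multiple of \<open>axis l 1\<close>
    isolate a single coefficient.\<close>
  have "(\<Sum>p\<in>UNIV. (\<Gamma> j i p x - \<Gamma> j p i x) * (y + (e/2) *\<^sub>R axis l 1) $ p) = 0"
    using \<open>e > 0\<close> by (intro eq e) simp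
  then have "(\<Sum>p\<in>UNIV. (\<Gamma> j i p x - \<Gamma> j p i x) * (e/2) * axis l 1 $ p) = 0"
    using eq[OF assms] by (simp add: distrib_left sum.distrib mult.assoc)
  moreover have "(\<Sum>p\<in>UNIV. (\<Gamma> j i p x - \<Gamma> j p i x) * (e/2) * axis l 1 $ p) = (\<Gamma> j i l x - \<Gamma> j l i x) * (e/2)"
    by (simp add: axis_def if_distrib cong: if_cong)
  ultimately show ?thesis using \<open>e > 0\<close> by simp
qed

text \<open>Lower the index of \<open>K\<close>. The 1/2 in \<open>H\<close> cancels the 2 in
  \<open>K_eq\<close>.\<close>

lemma euler_lagrange:
  assumes z: "(x, y) \<in> D"
  shows "(\<Sum>j\<in>UNIV. (\<Sum>i\<in>UNIV. \<Sum>l\<in>UNIV. \<Gamma> j i l x * y $ i * y $ l) * dy k (dy j E) (x, y)) = q k (x, y)"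
proof -
  have half: "dy j (\<lambda>u. 1/2 * E u) u = 1/2 * dy j E u" if "u \<in> D" for j u
    unfolding dy_def
    by (rule dir_deriv_eq) (intro has_derivative_mult_right smooth_on_has_derivative[OF E(1) that])
  have "H (x, y) $ k $ j = 1/2 * dy k (dy j E) (x, y)" for j
  proof -
    have "dy k (dy j (\<lambda>u. 1/2 * E u)) (x, y) = dy k (\<lambda>u. 1/2 * dy j E u) (x, y)"
      unfolding dy_def[of k] by (rule dir_deriv_cong[OF D(1) z half])
    also have "\<dots> = 1/2 * dy k (dy j E) (x, y)"
      unfolding dy_def[of k]
      by (rule dir_deriv_eq)
        (intro has_derivative_mult_right smooth_on_has_derivative[OF smooth_dy[OF E(1)] z])
    finally show ?thesis by (simp add: H_def)
  qed
  then have "(\<Sum>j\<in>UNIV. (\<Sum>i\<in>UNIV. \<Sum>l\<in>UNIV. \<Gamma> j i l x * y $ i * y $ l) * dy k (dy j E) (x, y))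
      = (\<Sum>j\<in>UNIV. H (x, y) $ k $ j * K j (x, y))"
    by (intro sum.cong) (simp_all only: K_eq[OF z], simp)
  also have "\<dots> = (H (x, y) *v (matrix_inv (H (x, y)) *v (\<chi> k. q k (x, y)))) $ k"
    by (simp add: matrix_vector_mult_def K_def)
  also have "\<dots> = q k (x, y)"
    by (simp add: matrix_vector_mul_assoc matrix_inv_right_left[OF H_inv[OF z]])
  finally show ?thesis .
qed

lemma dx_dy_commute:
  assumes "z \<in> D"
  shows "dx l (dy k E) z = dy k (dx l E) z"
  unfolding dx_def dy_def by (rule dir_deriv_commute[OF D(1) E(1) assms])

text \<open>Conservation of energy along geodesics. Euler's identity for \<open>dy j E\<close>, of
  degree 1, introduces the Hessian, to which \<open>euler_lagrange\<close> applies. Euler's identity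
  for \<open>dx l E\<close>, of degree 2, then leaves 2 - 1 = 1 copy of the right-hand side.\<close>

lemma spray_annihilates_energy:
  assumes z: "(x, y) \<in> D"
  shows "(\<Sum>j\<in>UNIV. (\<Sum>i\<in>UNIV. \<Sum>l\<in>UNIV. \<Gamma> j i l x * y $ i * y $ l) * dy j E (x, y))
    = (\<Sum>l\<in>UNIV. y $ l * dx l E (x, y))"
proof -
  let ?G = "\<lambda>j. \<Sum>i\<in>UNIV. \<Sum>l\<in>UNIV. \<Gamma> j i l x * y $ i * y $ l"
  have E1: "fibre_homogeneous D 1 (dy j E)" for j
    using E(2) by (intro fibre_homogeneous_dy D E) (simp add: numeral_2_eq_2)
  have "(\<Sum>j\<in>UNIV. ?G j * dy j E (x, y)) = (\<Sum>j\<in>UNIV. ?G j * (\<Sum>k\<in>UNIV. y $ k * dy k (dy j E) (x, y)))"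
    using euler_identity[OF D smooth_dy[OF E(1)] E1 z] by simp
  also have "\<dots> = (\<Sum>k\<in>UNIV. y $ k * (\<Sum>j\<in>UNIV. ?G j * dy k (dy j E) (x, y)))"
    by (rule sum_mult_swap)
  also have "\<dots> = (\<Sum>k\<in>UNIV. y $ k * q k (x, y))" by (simp add: euler_lagrange[OF z])
  also have "\<dots> = (\<Sum>l\<in>UNIV. y $ l * (\<Sum>k\<in>UNIV. y $ k * dy k (dx l E) (x, y))) - (\<Sum>k\<in>UNIV. y $ k * dx k E (x, y))"
    unfolding q_def right_diff_distrib sum_subtractf dx_dy_commute[OF z]
    by (subst sum_mult_swap) simp
  also have "\<dots> = (\<Sum>l\<in>UNIV. y $ l * dx l E (x, y))"
    using euler_identity[OF D smooth_dx[OF E(1)] fibre_homogeneous_dx[OF D E] z]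
    by (simp add: sum_distrib_left[symmetric] mult.left_commute[of _ 2])
  finally show ?thesis .
qed

text \<open>Differentiate the conservation law in the k-th fibre direction and subtract
  \<open>euler_lagrange\<close>. The mixed second derivatives cancel, and twice the claim remains;
  the symmetry of \<open>\<Gamma>\<close> makes the two contractions of its derivative
  equal.\<close>

lemma energy_horizontally_constant:
  assumes z: "(x, y) \<in> D"
  shows "dx k E (x, y) = (\<Sum>j\<in>UNIV. (\<Sum>l\<in>UNIV. \<Gamma> j k l x * y $ l) * dy j E (x, y))"
proof -
  let ?G = "\<lambda>j y. \<Sum>i\<in>UNIV. \<Sum>l\<in>UNIV. \<Gamma> j i l x * y $ i * y $ l"
  let ?N = "\<lambda>j. \<Sum>l\<in>UNIV. \<Gamma> j k l x * y $ l"
  let ?c = "\<lambda>t::real. y + t *\<^sub>R axis k 1"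
  have N: "?N j + (\<Sum>l\<in>UNIV. \<Gamma> j l k x * y $ l) = 2 * ?N j" for j
    by (simp add: connection_symmetric[OF z, of j _ k])
  have "((\<lambda>t. \<Sum>j\<in>UNIV. ?G j (?c t) * dy j E (x, ?c t)) has_real_derivative
      (\<Sum>j\<in>UNIV. 2 * ?N j * dy j E (x, ?c 0) + dy k (dy j E) (x, y) * ?G j (?c 0))) (at 0)"
    by (intro DERIV_sum DERIV_mult has_real_derivative_fibre smooth_dy E z
        quadratic_has_derivative[of _ x y k, unfolded N])
  then have 1: "((\<lambda>t. \<Sum>l\<in>UNIV. ?c t $ l * dx l E (x, ?c t)) has_real_derivative
      (\<Sum>j\<in>UNIV. 2 * ?N j * dy j E (x, ?c 0) + dy k (dy j E) (x, y) * ?G j (?c 0))) (at 0)"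
    using transform_fibre[where f="\<lambda>u. \<Sum>j\<in>UNIV. ?G j (snd u) * dy j E u"
        and g="\<lambda>y. \<Sum>l\<in>UNIV. y $ l * dx l E (x, y)", OF _ z] spray_annihilates_energy by simp
  have e: "((\<lambda>t. ?c t $ l) has_real_derivative (if l = k then 1 else 0)) (at 0)" for l
    by (auto simp: axis_def intro!: derivative_eq_intros)
  have "((\<lambda>t. \<Sum>l\<in>UNIV. ?c t $ l * dx l E (x, ?c t)) has_real_derivative
      (\<Sum>l\<in>UNIV. (if l = k then 1 else 0) * dx l E (x, ?c 0) + dy k (dx l E) (x, y) * ?c 0 $ l)) (at 0)"
    by (intro DERIV_sum DERIV_mult has_real_derivative_fibre smooth_dx E z e)
  from DERIV_unique[OF 1 this]
  have "2 * (\<Sum>j\<in>UNIV. ?N j * dy j E (x, y)) + (\<Sum>j\<in>UNIV. ?G j y * dy k (dy j E) (x, y))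
      = dx k E (x, y) + (\<Sum>l\<in>UNIV. y $ l * dy k (dx l E) (x, y))"
    by (simp add: sum.distrib sum_distrib_left[symmetric] mult.assoc mult.commute[of "dy k _ _"]
        if_distrib[of "\<lambda>c. c * _"] cong: if_cong)
  then show ?thesis
    unfolding euler_lagrange[OF z] by (simp add: q_def dx_dy_commute[OF z])
qed

end

subsection \<open>Divisibility of cubic forms\<close>

lemma symmetric_matrix_inner:
  fixes M :: "real^'n^'n"
  assumes "transpose M = M"
  shows "x \<bullet> (M *v y) = y \<bullet> (M *v x)"
  by (metis assms dot_lmul_matrix inner_commute transpose_matrix_vector)

lemma exists_orthogonal_vector:
  fixes b :: "real^'n"
  assumes "CARD('n) > 1"
  shows "\<exists>u. u \<noteq> 0 \<and> b \<bullet> u = 0"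
proof (cases "b = 0")
  case True
  then show ?thesis by (intro exI[of _ "axis undefined 1"]) (simp add: axis_eq_0_iff)
next
  case False
  then have "dim {u. b \<bullet> u = 0} \<noteq> 0"
    using assms by (simp add: dim_hyperplane)
  then have "\<not> {u. b \<bullet> u = 0} \<subseteq> {0}" by (simp add: dim_eq_0)
  then show ?thesis by blast
qed

lemma quadratic_form_eq_0:
  fixes T :: "real^'n^'n"
  assumes T: "transpose T = T" and 0: "\<And>y. y \<bullet> (T *v y) = 0"
  shows "T = 0"
proof -
  have "x \<bullet> (T *v y) = 0" for x y
    using 0[of "x + y"] 0[of x] 0[of y] symmetric_matrix_inner[OF T, of x y]
    by (simp add: matrix_vector_right_distrib inner_add_left inner_add_right)
  then have "T *v y = 0" for y using inner_eq_zero_iff by blast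
  then show ?thesis by (simp add: matrix_eq)
qed

text \<open>On the hyperplane where b vanishes, the identity forces \<open>l\<close> to vanish
  wherever the form of \<open>M\<close> does not. That form is not identically zero there, so
  \<open>l\<close> vanishes on the whole hyperplane and is a multiple of \<open>b\<close>. Off the
  hyperplane \<open>b \<bullet> y\<close> can then be cancelled.\<close>

lemma linear_quadratic_factor:
  fixes M S :: "real^'n^'n" and b l \<beta> :: "real^'n"
  assumes M: "transpose M = M" "invertible M" and S: "transpose S = S"
    and \<beta>: "M *v \<beta> = b" and s: "b \<bullet> \<beta> \<noteq> 0" and n: "CARD('n) > 1"
    and id: "\<And>y. (b \<bullet> y) * (y \<bullet> (S *v y)) = (y \<bullet> (M *v y)) * (l \<bullet> y)"
  shows "\<exists>c. l = c *\<^sub>R b \<and> S = c *\<^sub>R M"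
proof -
  note dist = matrix_vector_right_distrib inner_add_left inner_add_right matrix_vector_mult_scaleR
  \<comment> \<open>The space is the direct sum of the kernel of b and the line of
    \<open>\<beta>\<close>, as \<open>b \<bullet> \<beta>\<close> is nonzero.\<close>
  have split: "\<exists>y0 k. y = y0 + k *\<^sub>R \<beta> \<and> b \<bullet> y0 = 0" for y
    using s by (intro exI[of _ "y - ((b \<bullet> y) / (b \<bullet> \<beta>)) *\<^sub>R \<beta>"] exI[of _ "(b \<bullet> y) / (b \<bullet> \<beta>)"])
      (simp add: inner_diff_right)
  \<comment> \<open>Otherwise, by polarization, a nonzero \<open>u\<close> in the kernel of b would
    be M-orthogonal to that kernel. It is also M-orthogonal to \<open>\<beta>\<close>, hence to
    everything, against the invertibility of \<open>M\<close>.\<close>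
  have "\<exists>z. b \<bullet> z = 0 \<and> z \<bullet> (M *v z) \<noteq> 0"
  proof (rule ccontr)
    assume "\<not> ?thesis"
    then have 0: "z \<bullet> (M *v z) = 0" if "b \<bullet> z = 0" for z using that by blast
    obtain u where u: "u \<noteq> 0" "b \<bullet> u = 0" using exists_orthogonal_vector[OF n] by blast
    have "y \<bullet> (M *v u) = 0" for y
    proof -
      obtain y0 k where y: "y = y0 + k *\<^sub>R \<beta>" "b \<bullet> y0 = 0" using split by blast
      have "y0 \<bullet> (M *v u) = 0"
        using 0[of "y0 + u"] 0[of y0] 0[of u] u y symmetric_matrix_inner[OF M(1), of y0 u]
        by (simp add: dist)
      moreover have "\<beta> \<bullet> (M *v u) = 0"
        using symmetric_matrix_inner[OF M(1), of \<beta> u] u by (simp add: \<beta> inner_commute)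
      ultimately show ?thesis by (simp add: y dist)
    qed
    then have "M *v u = 0" using inner_eq_zero_iff by blast
    then have "matrix_inv M *v (M *v u) = 0" by simp
    then show False using u by (simp add: matrix_vector_mul_assoc matrix_inv_right_left[OF M(2)])
  qed
  then obtain z where z: "b \<bullet> z = 0" "z \<bullet> (M *v z) \<noteq> 0" by blast
  have l0: "l \<bullet> y = 0" if "b \<bullet> y = 0" "y \<bullet> (M *v y) \<noteq> 0" for y
    using id[of y] that by simp
  have l: "l \<bullet> y = 0" if y: "b \<bullet> y = 0" for y
  proof (cases "y \<bullet> (M *v y) = 0")
    case True
    \<comment> \<open>Move a null vector y in the direction of \<open>z\<close>: the form becomes t
      times an affine function of t with nonzero slope. The latter has a single root, so t = 1 or t
      = 2 reaches a non-null vector.\<close>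
    have q: "(y + t *\<^sub>R z) \<bullet> (M *v (y + t *\<^sub>R z)) = t * (2 * (y \<bullet> (M *v z)) + t * (z \<bullet> (M *v z)))" for t
      using True symmetric_matrix_inner[OF M(1), of y z]
      by (simp add: dist algebra_simps)
    obtain t where t: "t \<noteq> 0" "2 * (y \<bullet> (M *v z)) + t * (z \<bullet> (M *v z)) \<noteq> 0"
    proof (cases "2 * (y \<bullet> (M *v z)) + 1 * (z \<bullet> (M *v z)) = 0")
      case True
      then show thesis using z by (intro that[of 2]) auto
    qed (use that[of 1] in simp)
    have "l \<bullet> (y + t *\<^sub>R z) = 0"
      using t y z by (intro l0) (simp_all only: q, simp_all add: inner_add_right)
    then show ?thesis using l0[OF z] by (simp add: inner_add_right)
  qed (use l0 y in blast)
  define c where "c = (l \<bullet> \<beta>) / (b \<bullet> \<beta>)"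
  have "(l - c *\<^sub>R b) \<bullet> y = 0" for y
  proof -
    obtain y0 k where y: "y = y0 + k *\<^sub>R \<beta>" "b \<bullet> y0 = 0" using split by blast
    show ?thesis using y l[OF y(2)] s by (simp add: c_def inner_diff_left inner_add_right)
  qed
  then have lc: "l = c *\<^sub>R b" using inner_eq_zero_iff[of "l - c *\<^sub>R b"] by simp
  define T where "T = S - c *\<^sub>R M"
  have T: "transpose T = T"
    using S M by (simp add: T_def transpose_def vec_eq_iff)
  have Tv: "T *v y = S *v y - c *\<^sub>R (M *v y)" for y
    by (simp add: T_def matrix_vector_mult_diff_rdistrib scaleR_matrix_vector_assoc)
  have T0: "y \<bullet> (T *v y) = 0" if "b \<bullet> y \<noteq> 0" for y
  proof -
    have "(b \<bullet> y) * (y \<bullet> (T *v y)) = 0"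
      using id[of y] by (simp add: Tv lc inner_diff_right algebra_simps)
    then show ?thesis using that by simp
  qed
  have "y \<bullet> (T *v y) = 0" for y
  proof (cases "b \<bullet> y = 0")
    case True
    \<comment> \<open>The vectors y + \<open>\<beta>\<close>, y - \<open>\<beta>\<close> and
      \<open>\<beta>\<close> all lie off the hyperplane. The parallelogram law expresses the value
      at y through theirs.\<close>
    have "(y + \<beta>) \<bullet> (T *v (y + \<beta>)) = 0" "(y + (-1) *\<^sub>R \<beta>) \<bullet> (T *v (y + (-1) *\<^sub>R \<beta>)) = 0" "\<beta> \<bullet> (T *v \<beta>) = 0"
      using True s by (intro T0; simp add: inner_add_right inner_diff_right)+
    then have "y \<bullet> (T *v y) + (\<beta> \<bullet> (T *v y) + y \<bullet> (T *v \<beta>)) = 0"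
      "y \<bullet> (T *v y) - (\<beta> \<bullet> (T *v y) + y \<bullet> (T *v \<beta>)) = 0"
      by (simp_all only: dist inner_scaleR_left inner_scaleR_right) simp_all
    then show ?thesis by linarith
  qed (rule T0)
  then have "T = 0" by (rule quadratic_form_eq_0[OF T])
  then show ?thesis using lc by (auto simp: T_def)
qed

section \<open>Polynomial forms restricted to lines\<close>

lemma poly_eq_0_if_locally_0:
  fixes p :: "real poly"
  assumes "e > 0" "\<And>t. \<bar>t\<bar> < e \<Longrightarrow> poly p t = 0"
  shows "p = 0"
proof (rule ccontr)
  assume "p \<noteq> 0"
  then have "finite {t. poly p t = 0}" by (rule poly_roots_finite)
  moreover have "{-e<..<e} \<subseteq> {t. poly p t = 0}" using assms(2) by auto
  ultimately have "finite {-e<..<e}" by (rule rev_finite_subset)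
  then show False using assms(1) by (simp add: infinite_Ioo)
qed

definition qpoly :: "real^'n^'n \<Rightarrow> real^'n \<Rightarrow> real^'n \<Rightarrow> real poly" where
  "qpoly M y v = [:y \<bullet> (M *v y), y \<bullet> (M *v v) + v \<bullet> (M *v y), v \<bullet> (M *v v):]"

lemma poly_qpoly: "poly (qpoly M y v) t = (y + t *\<^sub>R v) \<bullet> (M *v (y + t *\<^sub>R v))"
  by (simp add: qpoly_def matrix_vector_right_distrib inner_add_left inner_add_right
      matrix_vector_mult_scaleR algebra_simps)

text \<open>Along the line from \<open>y0\<close> to y, the difference of the two sides is a
  polynomial that vanishes near parameter 0, hence also at parameter 1, which is y.\<close>

lemma cubic_identity_extends:
  fixes M S :: "real^'n^'n" and b l :: "real^'n"
  assumes V: "open V" "y0 \<in> V"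
    and id: "\<And>y. y \<in> V \<Longrightarrow> (b \<bullet> y) * (y \<bullet> (S *v y)) = (y \<bullet> (M *v y)) * (l \<bullet> y)"
  shows "(b \<bullet> y) * (y \<bullet> (S *v y)) = (y \<bullet> (M *v y)) * (l \<bullet> y)"
proof -
  let ?v = "y - y0"
  obtain e where e: "e > 0" "\<And>t. \<bar>t\<bar> < e \<Longrightarrow> y0 + t *\<^sub>R ?v \<in> V"
    using open_line[OF V] by blast
  define p where "p = [:b \<bullet> y0, b \<bullet> ?v:] * qpoly S y0 ?v - qpoly M y0 ?v * [:l \<bullet> y0, l \<bullet> ?v:]"
  have p: "poly p t = (b \<bullet> (y0 + t *\<^sub>R ?v)) * ((y0 + t *\<^sub>R ?v) \<bullet> (S *v (y0 + t *\<^sub>R ?v)))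
      - ((y0 + t *\<^sub>R ?v) \<bullet> (M *v (y0 + t *\<^sub>R ?v))) * (l \<bullet> (y0 + t *\<^sub>R ?v))" for t
    unfolding p_def poly_diff poly_mult poly_qpoly by (simp add: inner_add_right)
  have "p = 0" by (rule poly_eq_0_if_locally_0[OF e(1)]) (simp only: p id[OF e(2)] diff_self)
  then have "poly p 1 = 0" by simp
  then show ?thesis unfolding p by simp
qed

text \<open>In the direction \<open>\<beta>\<close> the quadratic and the linear form have the same
  leading coefficient \<open>b \<bullet> \<beta>\<close>, which is nonzero. So their product cannot
  vanish on an interval.\<close>

lemma exists_nonnull_near:
  fixes M :: "real^'n^'n" and b \<beta> :: "real^'n"
  assumes V: "open V" "y0 \<in> V" and \<beta>: "M *v \<beta> = b" "b \<bullet> \<beta> \<noteq> 0"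
  obtains y where "y \<in> V" "y \<bullet> (M *v y) \<noteq> 0" "b \<bullet> y \<noteq> 0"
proof (rule ccontr)
  assume "\<not> thesis"
  then have 0: "(y \<bullet> (M *v y)) * (b \<bullet> y) = 0" if "y \<in> V" for y
    using that \<open>\<And>y. \<lbrakk>y \<in> V; y \<bullet> (M *v y) \<noteq> 0; b \<bullet> y \<noteq> 0\<rbrakk> \<Longrightarrow> thesis\<close> by auto
  obtain e where e: "e > 0" "\<And>t. \<bar>t\<bar> < e \<Longrightarrow> y0 + t *\<^sub>R \<beta> \<in> V"
    using open_line[OF V] by blast
  have "qpoly M y0 \<beta> * [:b \<bullet> y0, b \<bullet> \<beta>:] = 0"
  proof (rule poly_eq_0_if_locally_0[OF e(1)])
    fix t :: real assume "\<bar>t\<bar> < e"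
    from 0[OF e(2)[OF this]] show "poly (qpoly M y0 \<beta> * [:b \<bullet> y0, b \<bullet> \<beta>:]) t = 0"
      unfolding poly_mult poly_qpoly by (simp add: inner_add_right)
  qed
  moreover have "\<beta> \<bullet> b \<noteq> 0" using \<beta>(2) by (simp add: inner_commute)
  ultimately show False using \<beta> by (simp add: qpoly_def)
qed

subsection \<open>Covariant derivatives of the metric and the one-form\<close>

lemma has_derivative_compose_fst:
  fixes f :: "'e::euclidean_space \<Rightarrow> real" and y :: "'e"
  assumes "f differentiable (at x)"
  shows "((\<lambda>u. f (fst u)) has_derivative (\<lambda>h. dir_deriv (fst h) f x)) (at (x, y))"
  using has_derivative_compose[OF has_derivative_fst[OF has_derivative_ident], of f "\<lambda>v. dir_deriv v f x" "(x, y)" UNIV]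
    has_derivative_dir_deriv[OF assms] by simp

lemma snd_nth_has_derivative:
  "((\<lambda>u :: ('e::real_normed_vector) \<times> (real^'n). snd u $ i) has_derivative (\<lambda>h. snd h $ i)) (at z)"
  by (intro bounded_linear_imp_has_derivative bounded_linear_compose[OF bounded_linear_vec_nth bounded_linear_snd])

lemma quadratic_form_has_derivative:
  fixes M :: "real^'n \<Rightarrow> real^'n^'n"
  assumes "\<And>i j. (\<lambda>x. M x $ i $ j) differentiable (at x)"
  shows "((\<lambda>u. snd u \<bullet> (M (fst u) *v snd u)) has_derivative
    (\<lambda>h. y \<bullet> ((\<chi> i j. dir_deriv (fst h) (\<lambda>x. M x $ i $ j) x) *v y)
       + snd h \<bullet> (M x *v y) + y \<bullet> (M x *v snd h))) (at (x, y))"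
proof -
  have d: "((\<lambda>u. M (fst u) $ i $ j) has_derivative (\<lambda>h. dir_deriv (fst h) (\<lambda>x. M x $ i $ j) x)) (at (x, y))"
    for i j
    by (rule has_derivative_compose_fst[OF assms])
  have "((\<lambda>u. \<Sum>i\<in>UNIV. snd u $ i * (\<Sum>j\<in>UNIV. M (fst u) $ i $ j * snd u $ j)) has_derivative
     (\<lambda>h. \<Sum>i\<in>UNIV. snd (x, y) $ i * (\<Sum>j\<in>UNIV. M (fst (x, y)) $ i $ j * snd h $ j +
         dir_deriv (fst h) (\<lambda>x. M x $ i $ j) x * snd (x, y) $ j)
       + snd h $ i * (\<Sum>j\<in>UNIV. M (fst (x, y)) $ i $ j * snd (x, y) $ j))) (at (x, y))"
    by (intro has_derivative_sum has_derivative_mult d snd_nth_has_derivative)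
  then show ?thesis
    by (simp add: inner_vec_def matrix_vector_mult_def sum.distrib distrib_left add_ac)
qed

lemma linear_form_has_derivative:
  fixes b :: "real^'n \<Rightarrow> real^'n"
  assumes "\<And>i. (\<lambda>x. b x $ i) differentiable (at x)"
  shows "((\<lambda>u. b (fst u) \<bullet> snd u) has_derivative
    (\<lambda>h. (\<chi> i. dir_deriv (fst h) (\<lambda>x. b x $ i) x) \<bullet> y + b x \<bullet> snd h)) (at (x, y))"
proof -
  have d: "((\<lambda>u. b (fst u) $ i) has_derivative (\<lambda>h. dir_deriv (fst h) (\<lambda>x. b x $ i) x)) (at (x, y))"
    for i
    by (rule has_derivative_compose_fst[OF assms])
  have "((\<lambda>u. \<Sum>i\<in>UNIV. b (fst u) $ i * snd u $ i) has_derivative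
     (\<lambda>h. \<Sum>i\<in>UNIV. b (fst (x, y)) $ i * snd h $ i + dir_deriv (fst h) (\<lambda>x. b x $ i) x * snd (x, y) $ i)) (at (x, y))"
    by (intro has_derivative_sum has_derivative_mult d snd_nth_has_derivative)
  then show ?thesis
    by (simp add: inner_vec_def sum.distrib add_ac)
qed

text \<open>The formula for \<open>E\<close> is imposed only where both forms are nonzero: the
  domain may meet their zero sets, where the absolute powers need not be differentiable.\<close>

locale kropina_energy = berwald_energy D E \<Gamma> H
  for D :: "((real^'n::finite) \<times> (real^'n)) set" and E \<Gamma> H +
  fixes U :: "(real^'n) set" and M :: "real^'n \<Rightarrow> real^'n^'n" and b :: "real^'n \<Rightarrow> real^'n" and m :: real
  assumes U: "open U" "fst ` D = U"
    and M: "\<And>i j. smooth_on U (\<lambda>x. M x $ i $ j)"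
    and M_sym: "\<And>x. x \<in> U \<Longrightarrow> transpose (M x) = M x"
    and M_inv: "\<And>x. x \<in> U \<Longrightarrow> invertible (M x)"
    and b: "\<And>i. smooth_on U (\<lambda>x. b x $ i)"
    and nonnull: "\<And>x. x \<in> U \<Longrightarrow> b x \<bullet> (matrix_inv (M x) *v b x) \<noteq> 0"
    and energy: "\<And>x y. (x, y) \<in> D \<Longrightarrow> y \<bullet> (M x *v y) \<noteq> 0 \<Longrightarrow> b x \<bullet> y \<noteq> 0 \<Longrightarrow>
      E (x, y) = \<bar>y \<bullet> (M x *v y)\<bar> powr (1 + m) * \<bar>b x \<bullet> y\<bar> powr (-2 * m)"
    and m: "m \<noteq> 0" and dim: "CARD('n) > 1"
begin

definition dM :: "'n \<Rightarrow> real^'n \<Rightarrow> real^'n^'n" where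
  "dM k x = (\<chi> i j. dir_deriv (axis k 1) (\<lambda>x. M x $ i $ j) x)"

definition db :: "'n \<Rightarrow> real^'n \<Rightarrow> real^'n" where
  "db k x = (\<chi> i. dir_deriv (axis k 1) (\<lambda>x. b x $ i) x)"

text \<open>Rows carry the upper index and k is the direction of differentiation, so that the
  covariant derivatives of the metric and of the one-form become
  \<open>dM - transpose G ** M - M ** G\<close> and \<open>db - transpose G *v b\<close>.\<close>

definition G :: "'n \<Rightarrow> real^'n \<Rightarrow> real^'n^'n" where
  "G k x = (\<chi> j l. \<Gamma> j k l x)"

definition \<beta> :: "real^'n \<Rightarrow> real^'n" where
  "\<beta> x = matrix_inv (M x) *v b x"

definition D1 :: "((real^'n) \<times> (real^'n)) set" where
  "D1 = {u \<in> D. snd u \<bullet> (M (fst u) *v snd u) \<noteq> 0 \<and> b (fst u) \<bullet> snd u \<noteq> 0}"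

lemma M_\<beta>: "x \<in> U \<Longrightarrow> M x *v \<beta> x = b x"
  by (simp add: \<beta>_def matrix_vector_mul_assoc matrix_inv_right_left[OF M_inv])

lemma M_\<beta>_nth: "x \<in> U \<Longrightarrow> (\<Sum>j\<in>UNIV. M x $ i $ j * \<beta> x $ j) = b x $ i"
  using M_\<beta>[of x] by (simp add: vec_eq_iff matrix_vector_mult_def)

lemma M_nth_sym: "x \<in> U \<Longrightarrow> M x $ i $ j = M x $ j $ i"
  using M_sym[of x] by (simp add: vec_eq_iff transpose_def)

lemma quadratic_has_derivative_D:
  "(x, y) \<in> D \<Longrightarrow> ((\<lambda>u. snd u \<bullet> (M (fst u) *v snd u)) has_derivative
    (\<lambda>h. y \<bullet> ((\<chi> i j. dir_deriv (fst h) (\<lambda>x. M x $ i $ j) x) *v y)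
       + snd h \<bullet> (M x *v y) + y \<bullet> (M x *v snd h))) (at (x, y))"
  using U(2) by (intro quadratic_form_has_derivative smooth_on_differentiable[OF M]) force

lemma linear_has_derivative_D:
  "(x, y) \<in> D \<Longrightarrow> ((\<lambda>u. b (fst u) \<bullet> snd u) has_derivative
    (\<lambda>h. (\<chi> i. dir_deriv (fst h) (\<lambda>x. b x $ i) x) \<bullet> y + b x \<bullet> snd h)) (at (x, y))"
  using U(2) by (intro linear_form_has_derivative smooth_on_differentiable[OF b]) force

lemma open_D1: "open D1"
proof -
  have "continuous_on D (\<lambda>u. snd u \<bullet> (M (fst u) *v snd u))" "continuous_on D (\<lambda>u. b (fst u) \<bullet> snd u)"
    using has_derivative_continuous[OF quadratic_has_derivative_D]
      has_derivative_continuous[OF linear_has_derivative_D]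
    by (intro continuous_at_imp_continuous_on ballI; force)+
  then have "open {u \<in> D. snd u \<bullet> (M (fst u) *v snd u) \<in> - {0}}" "open {u \<in> D. b (fst u) \<bullet> snd u \<in> - {0}}"
    using continuous_open_preimage[OF _ D(1), of _ "-{0}"] by (auto simp: vimage_def Int_def)
  moreover have "D1 = {u \<in> D. snd u \<bullet> (M (fst u) *v snd u) \<in> - {0}} \<inter> {u \<in> D. b (fst u) \<bullet> snd u \<in> - {0}}"
    by (auto simp: D1_def)
  ultimately show ?thesis by auto
qed

lemma fibre_D1:
  assumes "x \<in> U"
  obtains y where "(x, y) \<in> D1"
proof -
  obtain y0 where y0: "(x, y0) \<in> D" using assms U(2) by auto
  have "open (Pair x -` D)" by (intro open_vimage D continuous_intros)
  from exists_nonnull_near[OF this _ M_\<beta>[OF assms]] nonnull[OF assms] y0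
  show thesis using that by (auto simp: \<beta>_def D1_def)
qed

text \<open>For m = -1 the energy is the square of \<open>b \<bullet> y\<close>. Its Hessian has
  rank one and kills every vector orthogonal to b, so it is singular in dimension above 1. The point
  \<open>x0\<close> witnesses that there is a fibre to look at.\<close>

lemma kropina_exponent:
  assumes x0: "x0 \<in> U"
  shows "m \<noteq> -1"
proof
  assume m1: "m = -1"
  obtain y where z: "(x0, y) \<in> D1" using fibre_D1[OF x0] by blast
  have E1: "E u = (b (fst u) \<bullet> snd u)\<^sup>2" if "u \<in> D1" for u
    using energy[of "fst u" "snd u"] that by (simp add: m1 D1_def)
  have dE: "dy j (\<lambda>u. 1/2 * E u) u = b (fst u) \<bullet> snd u * b (fst u) $ j" if u: "u \<in> D1" for u j
  proof -
    have "dy j (\<lambda>u. 1/2 * E u) u = dy j (\<lambda>u. 1/2 * (b (fst u) \<bullet> snd u)\<^sup>2) u"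
      unfolding dy_def using E1 by (intro dir_deriv_cong[OF open_D1 u]) simp
    also have "\<dots> = b (fst u) \<bullet> snd u * b (fst u) $ j"
    proof -
      have "(fst u, snd u) \<in> D" using u by (simp add: D1_def)
      note l = linear_has_derivative_D[OF this]
      \<comment> \<open>A fibre direction has zero base component, so the term with derivatives of
        the coefficients drops out.\<close>
      have "dir_deriv 0 (\<lambda>x. b x $ i) (fst u) = 0" for i
        using u U(2) by (intro linear_0 linear_dir_deriv smooth_on_differentiable[OF b]) (auto simp: D1_def)
      then have "(\<chi> i. dir_deriv 0 (\<lambda>x. b x $ i) (fst u)) = 0" by (simp add: vec_eq_iff)
      then show ?thesis
        unfolding dy_def
        using dir_deriv_eq[OF has_derivative_mult_right[OF has_derivative_power[OF l, of 2], of "1/2"], of "(0, axis j 1)"]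
        by (simp add: inner_axis)
    qed
    finally show ?thesis .
  qed
  have HH: "H (x0, y) $ i $ j = b x0 $ i * b x0 $ j" for i j
  proof -
    have "dy i (dy j (\<lambda>u. 1/2 * E u)) (x0, y) = dy i (\<lambda>u. b (fst u) \<bullet> snd u * b (fst u) $ j) (x0, y)"
      unfolding dy_def[of i] by (intro dir_deriv_cong[OF open_D1 z] dE)
    also have "\<dots> = b x0 $ i * b x0 $ j"
    proof -
      have "dir_deriv 0 (\<lambda>x. b x $ i) x0 = 0" for i
        using x0 by (intro linear_0 linear_dir_deriv smooth_on_differentiable[OF b])
      moreover from this have "(\<chi> i. dir_deriv 0 (\<lambda>x. b x $ i) x0) = 0" by (simp add: vec_eq_iff)
      ultimately show ?thesis
        unfolding dy_def
        using dir_deriv_eq[OF has_derivative_mult[OF linear_has_derivative_D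
            has_derivative_compose_fst[OF smooth_on_differentiable[OF b x0]]], of y "(0, axis i 1)" j] z
        by (simp add: inner_axis D1_def)
    qed
    finally show ?thesis by (simp add: H_def)
  qed
  obtain u where u: "u \<noteq> 0" "b x0 \<bullet> u = 0" using exists_orthogonal_vector[OF dim] by blast
  have "H (x0, y) *v u = (b x0 \<bullet> u) *\<^sub>R b x0"
    by (simp add: vec_eq_iff matrix_vector_mult_def HH inner_vec_def sum_distrib_left mult_ac)
  then have "matrix_inv (H (x0, y)) *v (H (x0, y) *v u) = 0" using u by simp
  then show False
    using u z by (simp add: matrix_vector_mul_assoc matrix_inv_right_left[OF H_inv] D1_def)
qed

text \<open>Horizontal constancy of \<open>E\<close> is expressed by its logarithmic derivative, in
  which the real powers disappear. Multiplying by both forms leaves a cubic polynomial identity in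
  y.\<close>

lemma horizontal_derivatives:
  assumes x: "x \<in> U" and z: "(x, y) \<in> D1"
  shows "((1 + m) *\<^sub>R b x \<bullet> y) * (y \<bullet> ((dM k x - transpose (G k x) ** M x - M x ** G k x) *v y))
    = (y \<bullet> (M x *v y)) * ((2 * m) *\<^sub>R (db k x - transpose (G k x) *v b x) \<bullet> y)"
proof -
  let ?q = "\<lambda>u. snd u \<bullet> (M (fst u) *v snd u)" and ?B = "\<lambda>u. b (fst u) \<bullet> snd u"
  let ?dq = "\<lambda>h. y \<bullet> ((\<chi> i j. dir_deriv (fst h) (\<lambda>x. M x $ i $ j) x) *v y)
       + snd h \<bullet> (M x *v y) + y \<bullet> (M x *v snd h)"
  let ?dB = "\<lambda>h. (\<chi> i. dir_deriv (fst h) (\<lambda>x. b x $ i) x) \<bullet> y + b x \<bullet> snd h"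
  let ?Q = "?q (x, y)" and ?L = "?B (x, y)" and ?Gy = "G k x *v y"
  \<comment> \<open>The logarithmic derivative of \<open>E\<close> in direction h.\<close>
  let ?e = "\<lambda>h. (1 + m) * inverse ?Q * ?dq h - 2 * m * inverse ?L * ?dB h"
  let ?P = "\<bar>?Q\<bar> powr (1 + m)" and ?R = "\<bar>?L\<bar> powr (- 2 * m)"
  have z': "(x, y) \<in> D" "?Q \<noteq> 0" "?L \<noteq> 0" using z by (auto simp: D1_def)
  have "((\<lambda>u. \<bar>?q u\<bar> powr (1 + m) * \<bar>?B u\<bar> powr (- 2 * m)) has_derivative
     (\<lambda>h. ?P * ((-2 * m) * ?R * inverse ?L * ?dB h) + ((1 + m) * ?P * inverse ?Q * ?dq h) * ?R)) (at (x, y))"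
    by (intro has_derivative_mult has_derivative_abs_powr quadratic_has_derivative_D linear_has_derivative_D z')
  then have "(E has_derivative
     (\<lambda>h. ?P * ((-2 * m) * ?R * inverse ?L * ?dB h) + ((1 + m) * ?P * inverse ?Q * ?dq h) * ?R)) (at (x, y))"
    by (rule has_derivative_transform_within_open[OF _ open_D1 z])
      (auto simp: D1_def energy)
  from dir_deriv_eq[OF this] have dE: "dir_deriv h E (x, y) = ?P * ?R * ?e h" for h
    by (simp add: algebra_simps)
  \<comment> \<open>Horizontal constancy as an equality of two directional derivatives; the common
    factor \<open>?P * ?R\<close> is nonzero and cancels.\<close>
  have "dir_deriv (axis k 1, 0) E (x, y) = dir_deriv (0, ?Gy) E (x, y)"
    using energy_horizontally_constant[OF z'(1), of k]
      dir_deriv_sum_axis(2)[OF smooth_on_differentiable[OF E(1) z'(1)], of ?Gy]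
    by (simp add: dx_def G_def matrix_vector_mult_def)
  then have e: "?e (axis k 1, 0) = ?e (0, ?Gy)"
    using z' by (simp add: dE)
  have "dir_deriv 0 (\<lambda>x. b x $ i) x = 0" for i
    using x by (intro linear_0 linear_dir_deriv smooth_on_differentiable[OF b])
  moreover have "dir_deriv 0 (\<lambda>x. M x $ i $ j) x = 0" for i j
    using x by (intro linear_0 linear_dir_deriv smooth_on_differentiable[OF M])
  ultimately have "(\<chi> i. dir_deriv 0 (\<lambda>x. b x $ i) x) = 0" "(\<chi> i j. dir_deriv 0 (\<lambda>x. M x $ i $ j) x) = 0"
    by (simp_all add: vec_eq_iff)
  with e have "(1 + m) * inverse ?Q * (y \<bullet> (dM k x *v y)) - 2 * m * inverse ?L * (db k x \<bullet> y)
      = (1 + m) * inverse ?Q * (?Gy \<bullet> (M x *v y) + y \<bullet> (M x *v ?Gy)) - 2 * m * inverse ?L * (b x \<bullet> ?Gy)"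
    by (simp add: dM_def db_def)
  then have "(1 + m) * ?L * (y \<bullet> (dM k x *v y) - ?Gy \<bullet> (M x *v y) - y \<bullet> (M x *v ?Gy))
      = 2 * m * ?Q * (db k x \<bullet> y - b x \<bullet> ?Gy)"
    using z' by (simp add: field_simps)
  moreover have "y \<bullet> ((dM k x - transpose (G k x) ** M x - M x ** G k x) *v y)
      = y \<bullet> (dM k x *v y) - ?Gy \<bullet> (M x *v y) - y \<bullet> (M x *v ?Gy)"
    by (simp add: matrix_vector_mult_diff_rdistrib inner_diff_right matrix_vector_mul_assoc[symmetric]
        dot_lmul_matrix[symmetric] transpose_matrix_vector inner_commute[of _ y])
       (metis dot_lmul_matrix inner_commute)
  moreover have "(db k x - transpose (G k x) *v b x) \<bullet> y = db k x \<bullet> y - b x \<bullet> ?Gy"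
    by (simp add: inner_diff_left transpose_matrix_vector dot_lmul_matrix)
  ultimately show ?thesis by (simp add: mult_ac)
qed

text \<open>Dividing the cubic identity by 1 + m puts it in the form of
  \<open>linear_quadratic_factor\<close>, with 2m/(1+m) times the derivative of the one-form as the
  linear form; undoing that scaling produces (1+m)/(2m).\<close>

lemma covariant_derivatives:
  assumes x: "x \<in> U"
  obtains c where "dM k x - transpose (G k x) ** M x - M x ** G k x = c *\<^sub>R M x"
    "db k x - transpose (G k x) *v b x = ((1 + m) / (2 * m) * c) *\<^sub>R b x"
proof -
  let ?S = "dM k x - transpose (G k x) ** M x - M x ** G k x"
  let ?l = "db k x - transpose (G k x) *v b x"
  have m1: "1 + m \<noteq> 0" using kropina_exponent[OF x] by linarith
  obtain y0 where y0: "(x, y0) \<in> D1" using fibre_D1[OF x] by blast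
  have V: "open (Pair x -` D1)" by (intro open_vimage open_D1 continuous_intros)
  have id: "((1 + m) *\<^sub>R b x \<bullet> y) * (y \<bullet> (?S *v y)) = (y \<bullet> (M x *v y)) * ((2 * m) *\<^sub>R ?l \<bullet> y)" for y
    by (rule cubic_identity_extends[OF V]) (use y0 horizontal_derivatives[OF x] in auto)
  have rescale: "p * S = Q * ((2 * m / (1 + m)) * L)" if "((1 + m) * p) * S = Q * ((2 * m) * L)" for p S Q L
    using that m1 by (simp add: field_simps)
  have id': "(b x \<bullet> y) * (y \<bullet> (?S *v y)) = (y \<bullet> (M x *v y)) * ((2 * m / (1 + m)) *\<^sub>R ?l \<bullet> y)" for y
    using id[of y] unfolding inner_scaleR_left by (rule rescale)
  have dM: "transpose (dM k x) = dM k x"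
  proof -
    have "dir_deriv v (\<lambda>x. M x $ i $ j) x = dir_deriv v (\<lambda>x. M x $ j $ i) x" for v i j
      by (intro dir_deriv_cong[OF U(1) x] M_nth_sym)
    then show ?thesis by (simp add: dM_def transpose_def vec_eq_iff)
  qed
  have "transpose (transpose (G k x) ** M x) = M x ** G k x" "transpose (M x ** G k x) = transpose (G k x) ** M x"
    by (simp_all only: matrix_transpose_mul transpose_transpose M_sym[OF x])
  moreover have "transpose (A - B - C) = transpose A - transpose B - transpose C" for A B C :: "real^'n^'n"
    by (simp add: transpose_def vec_eq_iff)
  ultimately have S: "transpose ?S = ?S" using dM by (simp only:) simp
  obtain c where c: "(2 * m / (1 + m)) *\<^sub>R ?l = c *\<^sub>R b x" "?S = c *\<^sub>R M x"
    using linear_quadratic_factor[OF M_sym[OF x] M_inv[OF x] S M_\<beta>[OF x] _ dim id'] nonnull[OF x, folded \<beta>_def]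
    by blast
  have "?l = ((1 + m) / (2 * m)) *\<^sub>R ((2 * m / (1 + m)) *\<^sub>R ?l)"
    using m m1 by simp
  then have "?l = ((1 + m) / (2 * m) * c) *\<^sub>R b x" unfolding c(1) by simp
  with c(2) show thesis by (rule that)
qed

section \<open>The squared norm of the one-form and the conformal factor\<close>

definition norm_sq :: "real^'n \<Rightarrow> real" where
  "norm_sq x = b x \<bullet> \<beta> x"

lemma norm_sq_nonzero: "x \<in> U \<Longrightarrow> norm_sq x \<noteq> 0"
  using nonnull by (simp add: norm_sq_def \<beta>_def)

lemma smooth_\<beta>: "smooth_on U (\<lambda>x. \<beta> x $ i)"
  unfolding \<beta>_def matrix_vector_mult_def
  by (simp, intro smooth_on_sum smooth_on_mult smooth_on_matrix_inv U M M_inv b)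

lemma smooth_norm_sq: "smooth_on U norm_sq"
  unfolding norm_sq_def[abs_def] inner_vec_def inner_real_def
  by (intro smooth_on_sum smooth_on_mult smooth_\<beta> U b)

text \<open>Differentiating M \<open>\<beta>\<close> = b avoids any derivative of the inverse
  matrix. The unknown derivative of \<open>\<beta>\<close> enters only through its product with
  M.\<close>

lemma norm_sq_derivative:
  assumes x: "x \<in> U"
  shows "dir_deriv (axis k 1) norm_sq x = 2 * (db k x \<bullet> \<beta> x) - \<beta> x \<bullet> (dM k x *v \<beta> x)"
proof -
  define d\<beta> where "d\<beta> = (\<chi> i. dir_deriv (axis k 1) (\<lambda>x. \<beta> x $ i) x)"
  note der = smooth_on_has_derivative[OF M x] smooth_on_has_derivative[OF b x] smooth_on_has_derivative[OF smooth_\<beta> x]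
  have "((\<lambda>x. \<Sum>i\<in>UNIV. b x $ i * \<beta> x $ i) has_derivative
    (\<lambda>v. \<Sum>i\<in>UNIV. b x $ i * dir_deriv v (\<lambda>x. \<beta> x $ i) x + dir_deriv v (\<lambda>x. b x $ i) x * \<beta> x $ i)) (at x)"
    by (intro has_derivative_sum has_derivative_mult der)
  from dir_deriv_eq[OF this, of "axis k 1"]
  have 1: "dir_deriv (axis k 1) norm_sq x = b x \<bullet> d\<beta> + db k x \<bullet> \<beta> x"
    by (simp add: norm_sq_def[abs_def] inner_vec_def d\<beta>_def db_def sum.distrib)
  have "M x *v d\<beta> + dM k x *v \<beta> x = db k x"
  proof -
    have "(\<Sum>j\<in>UNIV. M x $ i $ j * d\<beta> $ j + dM k x $ i $ j * \<beta> x $ j) = db k x $ i" for i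
    proof -
      have "((\<lambda>x. \<Sum>j\<in>UNIV. M x $ i $ j * \<beta> x $ j) has_derivative
        (\<lambda>v. \<Sum>j\<in>UNIV. M x $ i $ j * dir_deriv v (\<lambda>x. \<beta> x $ j) x + dir_deriv v (\<lambda>x. M x $ i $ j) x * \<beta> x $ j)) (at x)"
        by (intro has_derivative_sum has_derivative_mult der)
      moreover have "dir_deriv (axis k 1) (\<lambda>x. \<Sum>j\<in>UNIV. M x $ i $ j * \<beta> x $ j) x = dir_deriv (axis k 1) (\<lambda>x. b x $ i) x"
        by (intro dir_deriv_cong[OF U(1) x] M_\<beta>_nth)
      ultimately show ?thesis
        using dir_deriv_eq[of "\<lambda>x. \<Sum>j\<in>UNIV. M x $ i $ j * \<beta> x $ j" _ x "axis k 1"] by (simp add: d\<beta>_def dM_def db_def)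
    qed
    then show ?thesis by (simp add: vec_eq_iff matrix_vector_mult_def sum.distrib)
  qed
  then have "M x *v d\<beta> = db k x - dM k x *v \<beta> x" by (simp add: eq_diff_eq)
  moreover have "b x \<bullet> d\<beta> = \<beta> x \<bullet> (M x *v d\<beta>)"
    using symmetric_matrix_inner[OF M_sym[OF x], of "\<beta> x" d\<beta>] by (simp add: M_\<beta>[OF x] inner_commute)
  ultimately show ?thesis using 1 by (simp add: inner_diff_right inner_commute)
qed

definition g :: "real^'n \<Rightarrow> real^'n^'n" where
  "g x = \<bar>norm_sq x\<bar> powr (- m) *\<^sub>R M x"

text \<open>The conclusion is the vanishing of the covariant derivative of \<open>g\<close> in
  coordinates: the factor contributes -c, which cancels the c of \<open>M\<close>.\<close>

lemma conformal_metric_parallel: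
  assumes x: "x \<in> U"
  shows "dir_deriv (axis k 1) (\<lambda>x. g x $ i $ j) x
    = (\<Sum>p\<in>UNIV. \<Gamma> p k i x * g x $ p $ j) + (\<Sum>p\<in>UNIV. \<Gamma> p k j x * g x $ i $ p)"
proof -
  obtain c where c: "dM k x - transpose (G k x) ** M x - M x ** G k x = c *\<^sub>R M x"
    "db k x - transpose (G k x) *v b x = ((1 + m) / (2 * m) * c) *\<^sub>R b x"
    using covariant_derivatives[OF x] by blast
  have dM': "dM k x = c *\<^sub>R M x + transpose (G k x) ** M x + M x ** G k x"
    using c(1) by (simp add: algebra_simps)
  have db': "db k x = ((1 + m) / (2 * m) * c) *\<^sub>R b x + transpose (G k x) *v b x"
    using c(2) by (simp add: algebra_simps)
  \<comment> \<open>These two equalities make all terms with \<open>G\<close> cancel from the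
    derivative of \<open>norm_sq\<close>, as they must for a scalar.\<close>
  have "\<beta> x \<bullet> (M x *v (G k x *v \<beta> x)) = b x \<bullet> (G k x *v \<beta> x)"
    using symmetric_matrix_inner[OF M_sym[OF x], of "\<beta> x" "G k x *v \<beta> x"] by (simp add: M_\<beta>[OF x] inner_commute)
  moreover have "\<beta> x \<bullet> (transpose (G k x) *v b x) = b x \<bullet> (G k x *v \<beta> x)"
    using dot_lmul_matrix[of "b x" "G k x" "\<beta> x"] by (simp add: transpose_matrix_vector inner_commute)
  ultimately have "dir_deriv (axis k 1) norm_sq x = (1 + m) / m * c * norm_sq x - c * norm_sq x"
    unfolding norm_sq_derivative[OF x] dM' db'
    by (simp add: matrix_vector_mult_add_rdistrib inner_add_right inner_add_left matrix_vector_mul_assoc[symmetric]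
        M_\<beta>[OF x] norm_sq_def inner_commute[of _ "\<beta> x"] scaleR_matrix_vector_assoc[symmetric])
  also have "\<dots> = c / m * norm_sq x" using m by (simp add: field_simps)
  finally have ds: "dir_deriv (axis k 1) norm_sq x = c / m * norm_sq x" .
  let ?\<sigma> = "\<bar>norm_sq x\<bar> powr (- m)"
  have "((\<lambda>x. \<bar>norm_sq x\<bar> powr (- m) * M x $ i $ j) has_derivative
    (\<lambda>v. ?\<sigma> * dir_deriv v (\<lambda>x. M x $ i $ j) x
      + ((- m) * ?\<sigma> * inverse (norm_sq x) * dir_deriv v norm_sq x) * M x $ i $ j)) (at x)"
    by (intro has_derivative_mult has_derivative_abs_powr norm_sq_nonzero x
        smooth_on_has_derivative[OF smooth_norm_sq] smooth_on_has_derivative[OF M])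
  from dir_deriv_eq[OF this, of "axis k 1"]
  have "dir_deriv (axis k 1) (\<lambda>x. g x $ i $ j) x = ?\<sigma> * (dM k x $ i $ j - c * M x $ i $ j)"
    using m norm_sq_nonzero[OF x] by (simp add: g_def ds dM_def field_simps)
  also have "\<dots> = ?\<sigma> * ((\<Sum>p\<in>UNIV. \<Gamma> p k i x * M x $ p $ j) + (\<Sum>p\<in>UNIV. M x $ i $ p * \<Gamma> p k j x))"
    by (simp add: dM' matrix_matrix_mult_def transpose_def G_def)
  finally show ?thesis by (simp add: g_def distrib_left sum_distrib_left mult_ac)
qed

text \<open>Koszul's computation: parallelism turns the three derivatives into six contractions, and
  symmetry of \<open>\<Gamma>\<close> and \<open>g\<close> cancels four of them.\<close>

lemma connection_is_levi_civita:
  assumes x: "x \<in> U"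
  shows "\<Gamma> k i j x = 1/2 * (\<Sum>l\<in>UNIV. matrix_inv (g x) $ k $ l *
        (dir_deriv (axis i 1) (\<lambda>x. g x $ j $ l) x + dir_deriv (axis j 1) (\<lambda>x. g x $ i $ l) x
         - dir_deriv (axis l 1) (\<lambda>x. g x $ i $ j) x))"
proof -
  obtain y where "(x, y) \<in> D" using fibre_D1[OF x] by (auto simp: D1_def)
  note sym = connection_symmetric[OF this]
  have gs: "g x $ p $ r = g x $ r $ p" for p r
    using M_nth_sym[OF x, of p r] by (simp add: g_def)
  have "\<bar>norm_sq x\<bar> powr (- m) \<noteq> 0" using norm_sq_nonzero[OF x] by simp
  then have gi: "invertible (g x)"
    using M_inv[OF x] unfolding g_def by (rule scalar_invertible)
  have "dir_deriv (axis i 1) (\<lambda>x. g x $ j $ l) x + dir_deriv (axis j 1) (\<lambda>x. g x $ i $ l) x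
         - dir_deriv (axis l 1) (\<lambda>x. g x $ i $ j) x = 2 * (\<Sum>p\<in>UNIV. g x $ l $ p * \<Gamma> p i j x)" for l
    unfolding conformal_metric_parallel[OF x] sym[of _ j i] sym[of _ l] gs[of _ l] gs[of _ i] gs[of _ j]
    by (simp add: mult_ac)
  then have "1/2 * (\<Sum>l\<in>UNIV. matrix_inv (g x) $ k $ l *
        (dir_deriv (axis i 1) (\<lambda>x. g x $ j $ l) x + dir_deriv (axis j 1) (\<lambda>x. g x $ i $ l) x
         - dir_deriv (axis l 1) (\<lambda>x. g x $ i $ j) x))
      = (matrix_inv (g x) *v (g x *v (\<chi> p. \<Gamma> p i j x))) $ k"
    by (simp add: matrix_vector_mult_def sum_distrib_left)
  also have "\<dots> = \<Gamma> k i j x"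
    by (simp add: matrix_vector_mul_assoc matrix_inv_right_left[OF gi])
  finally show ?thesis by simp
qed

end

subsection \<open>Tangent vectors in charts\<close>

locale manifold =
  fixes X :: "'a topology" and \<A> :: "('a, 'n::finite) chart set"
  assumes manifold: "smooth_manifold X \<A>"
begin

lemma chart_dom_open: "c \<in> \<A> \<Longrightarrow> openin X (chart_dom c)"
  and chart_img_open: "c \<in> \<A> \<Longrightarrow> open (chart_img c)"
  and chart_homeomorphic: "c \<in> \<A> \<Longrightarrow>
    homeomorphic_map (subtopology X (chart_dom c)) (top_of_set (chart_img c)) (chart_map c)"
  and chart_cover: "(\<Union>c\<in>\<A>. chart_dom c) = topspace X"
  and transition_smooth: "c \<in> \<A> \<Longrightarrow> d \<in> \<A> \<Longrightarrow>
    smooth_on (chart_map c ` (chart_dom c \<inter> chart_dom d)) (transition c d)"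
  using manifold by (auto simp: smooth_manifold_def is_chart_def)

lemma chart_inj: "c \<in> \<A> \<Longrightarrow> inj_on (chart_map c) (chart_dom c)"
  using homeomorphic_imp_injective_map[OF chart_homeomorphic] openin_subset[OF chart_dom_open]
  by (simp add: topspace_subtopology inf_absorb2)

lemma chart_inv_dom: "x \<in> chart_img c \<Longrightarrow> chart_inv c x \<in> chart_dom c"
  and chart_map_inv: "x \<in> chart_img c \<Longrightarrow> chart_map c (chart_inv c x) = x"
  by (simp_all add: chart_img_def chart_inv_def inv_into_into f_inv_into_f)

lemma chart_inv_map: "c \<in> \<A> \<Longrightarrow> p \<in> chart_dom c \<Longrightarrow> chart_inv c (chart_map c p) = p"
  by (simp add: chart_inv_def chart_inj)

lemma chart_map_img: "p \<in> chart_dom c \<Longrightarrow> chart_map c p \<in> chart_img c"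
  by (simp add: chart_img_def)

lemma chart_image_open:
  assumes c: "c \<in> \<A>" and W: "openin X W" "W \<subseteq> chart_dom c"
  shows "open (chart_map c ` W)"
proof -
  have "openin (subtopology X (chart_dom c)) W"
    using W by (auto simp: openin_subtopology)
  then have "openin (top_of_set (chart_img c)) (chart_map c ` W)"
    using homeomorphic_imp_open_map[OF chart_homeomorphic[OF c]] by (simp add: open_map_def)
  then show ?thesis
    using chart_img_open[OF c] openin_open_trans by blast
qed

lemma transition_map:
  "c \<in> \<A> \<Longrightarrow> p \<in> chart_dom c \<Longrightarrow> transition c d (chart_map c p) = chart_map d p"
  by (simp add: transition_def chart_inv_map)

lemma transition_has_derivative:
  assumes "c \<in> \<A>" "d \<in> \<A>" "p \<in> chart_dom c" "p \<in> chart_dom d"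
  shows "(transition c d has_derivative frechet_derivative (transition c d) (at (chart_map c p)))
    (at (chart_map c p))"
  using smooth_on_differentiable[OF transition_smooth[OF assms(1,2)], of "chart_map c p"] assms
  by (simp add: frechet_derivative_works[symmetric])

lemma transition_derivative_comp:
  assumes c: "c \<in> \<A>" "d \<in> \<A>" "e \<in> \<A>" and p: "p \<in> chart_dom c" "p \<in> chart_dom d" "p \<in> chart_dom e"
  shows "frechet_derivative (transition c e) (at (chart_map c p)) y
    = frechet_derivative (transition d e) (at (chart_map d p))
        (frechet_derivative (transition c d) (at (chart_map c p)) y)"
proof -
  \<comment> \<open>The direct transition and the composite one are compared over the triple
    overlap, whose image is an open neighbourhood of the point.\<close>
  let ?W = "chart_dom c \<inter> chart_dom d \<inter> chart_dom e"
  have W: "open (chart_map c ` ?W)"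
    using c by (intro chart_image_open openin_Int chart_dom_open) auto
  have "(transition d e has_derivative frechet_derivative (transition d e) (at (chart_map d p)))
      (at (transition c d (chart_map c p)))"
    using transition_has_derivative[of d e p] c p by (simp add: transition_map)
  from has_derivative_compose[OF transition_has_derivative this] c p
  have "((\<lambda>x. transition d e (transition c d x)) has_derivative
    (\<lambda>y. frechet_derivative (transition d e) (at (chart_map d p))
        (frechet_derivative (transition c d) (at (chart_map c p)) y))) (at (chart_map c p))"
    by blast
  then have "(transition c e has_derivative
    (\<lambda>y. frechet_derivative (transition d e) (at (chart_map d p))
        (frechet_derivative (transition c d) (at (chart_map c p)) y))) (at (chart_map c p))"
    by (rule has_derivative_transform_within_open[OF _ W]) (use c p in \<open>auto simp: transition_map\<close>)
  from frechet_derivative_at[OF this] show ?thesis by metis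
qed

lemma transition_derivative_self:
  assumes "c \<in> \<A>" "p \<in> chart_dom c"
  shows "frechet_derivative (transition c c) (at (chart_map c p)) y = y"
proof -
  have "(transition c c has_derivative (\<lambda>y. y)) (at (chart_map c p))"
    by (rule has_derivative_transform_within_open[OF has_derivative_ident chart_img_open[OF assms(1)]])
      (use assms in \<open>auto simp: transition_def chart_map_inv chart_map_img\<close>)
  from frechet_derivative_at[OF this] show ?thesis by metis
qed

lemma tangent_vector_self: "c \<in> \<A> \<Longrightarrow> p \<in> chart_dom c \<Longrightarrow> tangent_vector \<A> c p y c = y"
  by (simp add: tangent_vector_def transition_derivative_self)

lemma tangent_vector_in: "c \<in> \<A> \<Longrightarrow> p \<in> chart_dom c \<Longrightarrow> tangent_vector \<A> c p y \<in> tangent_space \<A> p"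
  by (auto simp: tangent_space_def tangent_vector_def intro: transition_derivative_comp)

text \<open>One component determines the whole family: the other charts around p follow by the
  Jacobians, and all remaining entries are normalized to 0.\<close>

lemma tangent_space_eq:
  assumes "c \<in> \<A>" "p \<in> chart_dom c" "v \<in> tangent_space \<A> p"
  shows "v = tangent_vector \<A> c p (v c)"
proof
  fix d
  show "v d = tangent_vector \<A> c p (v c) d"
  proof (cases "d \<in> \<A> \<and> p \<in> chart_dom d")
    case True
    then have "v d = frechet_derivative (transition c d) (at (chart_map c p)) (v c)"
      using assms unfolding tangent_space_def by blast
    then show ?thesis using True by (simp add: tangent_vector_def)
  next
    case False
    then have "v d = 0" using assms(3) unfolding tangent_space_def by blast
    then show ?thesis using False by (auto simp: tangent_vector_def)
  qed
qed

lemma tangent_vector_lincomb: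
  assumes "c \<in> \<A>" "p \<in> chart_dom c"
  shows "tangent_vector \<A> c p (r *\<^sub>R y + s *\<^sub>R w)
    = tvec_lincomb r (tangent_vector \<A> c p y) s (tangent_vector \<A> c p w)"
proof -
  have "linear (frechet_derivative (transition c d) (at (chart_map c p)))" if "d \<in> \<A>" "p \<in> chart_dom d" for d
    using transition_has_derivative[of c d p] assms that by (blast intro: has_derivative_linear)
  then show ?thesis
    by (auto simp: tangent_vector_def tvec_lincomb_def fun_eq_iff linear_add linear_cmul)
qed

lemma tangent_vector_scale:
  assumes "c \<in> \<A>" "p \<in> chart_dom c"
  shows "tangent_vector \<A> c p (r *\<^sub>R y) = tvec_scale r (tangent_vector \<A> c p y)"
  using tangent_vector_lincomb[OF assms, of r y 0 0] by (simp add: tvec_lincomb_def tvec_scale_def)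

lemma linear_on_tangent_components:
  assumes c: "c \<in> \<A>" "p \<in> chart_dom c" and l: "linear_on_tangent \<A> p l"
  shows "l (tangent_vector \<A> c p y) = (\<Sum>i\<in>UNIV. y $ i * l (coord_vector \<A> c p i))"
proof -
  let ?h = "\<lambda>y. l (tangent_vector \<A> c p y)"
  have h: "?h (r *\<^sub>R y + s *\<^sub>R w) = r * ?h y + s * ?h w" for r s y w
    using l c by (simp add: tangent_vector_lincomb tangent_vector_in linear_on_tangent_def)
  have "linear ?h"
    using h[of 1 _ 1] h[of _ _ 0 0] by (intro linearI) simp_all
  then have "?h (\<Sum>i\<in>UNIV. y $ i *\<^sub>R axis i 1) = (\<Sum>i\<in>UNIV. y $ i * ?h (axis i 1))"
    using linear_sum[of ?h "\<lambda>i. y $ i *\<^sub>R axis i 1" UNIV] linear_cmul[of ?h] by simp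
  moreover have "(\<Sum>i\<in>UNIV. y $ i *\<^sub>R axis i 1) = y"
    using basis_expansion[of y] by (simp add: scalar_mult_eq_scaleR)
  ultimately show ?thesis by (simp add: coord_vector_def)
qed

end

section \<open>The metric and the one-form in charts\<close>

locale metric_form_manifold = manifold X \<A>
  for X :: "'a topology" and \<A> :: "('a, 'n::finite) chart set" +
  fixes a :: "'a \<Rightarrow> ('a, 'n) tvec \<Rightarrow> ('a, 'n) tvec \<Rightarrow> real" and b :: "'a \<Rightarrow> ('a, 'n) tvec \<Rightarrow> real"
  assumes metric: "pseudo_riemannian_metric X \<A> a" and form: "one_form X \<A> b"
    and non_null: "nowhere_null \<A> a b"
begin

definition metric_mat :: "('a, 'n) chart \<Rightarrow> real^'n \<Rightarrow> real^'n^'n" where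
  "metric_mat c x = (\<chi> i j. metric_comp \<A> a c i j x)"

definition form_vec :: "('a, 'n) chart \<Rightarrow> real^'n \<Rightarrow> real^'n" where
  "form_vec c x = (\<chi> i. form_comp \<A> b c i x)"

lemma chart_point:
  assumes "c \<in> \<A>" "x \<in> chart_img c"
  shows "chart_inv c x \<in> topspace X"
  using chart_cover chart_inv_dom[OF assms(2)] assms(1) by auto

lemma metric_in_chart:
  assumes c: "c \<in> \<A>" and x: "x \<in> chart_img c"
  shows "a (chart_inv c x) (tangent_vector \<A> c (chart_inv c x) y) (tangent_vector \<A> c (chart_inv c x) w)
    = y \<bullet> (metric_mat c x *v w)"
proof -
  let ?p = "chart_inv c x"
  let ?t = "tangent_vector \<A> c ?p"
  note p = chart_inv_dom[OF x]
  have a: "linear_on_tangent \<A> ?p (a ?p v)" "a ?p v u = a ?p u v"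
    if "v \<in> tangent_space \<A> ?p" "u \<in> tangent_space \<A> ?p" for u v
    using metric chart_point[OF c x] that by (auto simp: pseudo_riemannian_metric_def)
  have t: "?t y \<in> tangent_space \<A> ?p" "coord_vector \<A> c ?p i \<in> tangent_space \<A> ?p" for y i
    using tangent_vector_in[OF c p] by (auto simp: coord_vector_def)
  have la: "a ?p v (?t y) = (\<Sum>i\<in>UNIV. y $ i * a ?p v (coord_vector \<A> c ?p i))"
    if "v \<in> tangent_space \<A> ?p" for v y
    by (rule linear_on_tangent_components[OF c p a(1)[OF that that]])
  have "a ?p (?t y) (coord_vector \<A> c ?p j) = (\<Sum>i\<in>UNIV. y $ i * metric_comp \<A> a c i j x)" for j
    unfolding a(2)[OF t(1) t(2)] la[OF t(2)] a(2)[OF t(2)[of j] t(2)] metric_comp_def Let_def ..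
  then have "a ?p (?t y) (?t w) = (\<Sum>j\<in>UNIV. w $ j * (\<Sum>i\<in>UNIV. y $ i * metric_comp \<A> a c i j x))"
    unfolding la[OF t(1), of _ w] by simp
  also have "\<dots> = y \<bullet> (metric_mat c x *v w)"
    unfolding metric_mat_def inner_vec_def matrix_vector_mult_def
    by (subst sum_mult_swap) (simp add: mult.commute)
  finally show ?thesis .
qed

lemma form_in_chart:
  assumes c: "c \<in> \<A>" and x: "x \<in> chart_img c"
  shows "b (chart_inv c x) (tangent_vector \<A> c (chart_inv c x) y) = form_vec c x \<bullet> y"
  using linear_on_tangent_components[OF c chart_inv_dom[OF x], of "b (chart_inv c x)" y]
    form chart_point[OF c x]
  by (simp add: one_form_def form_vec_def form_comp_def Let_def inner_vec_def mult.commute)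

lemma metric_mat_sym:
  assumes c: "c \<in> \<A>" and x: "x \<in> chart_img c"
  shows "transpose (metric_mat c x) = metric_mat c x"
proof -
  have "metric_comp \<A> a c i j x = metric_comp \<A> a c j i x" for i j
    using metric chart_point[OF c x] tangent_vector_in[OF c chart_inv_dom[OF x]]
    by (simp add: pseudo_riemannian_metric_def metric_comp_def Let_def coord_vector_def)
  then show ?thesis by (simp add: metric_mat_def transpose_def)
qed

lemma metric_mat_invertible:
  assumes c: "c \<in> \<A>" and x: "x \<in> chart_img c"
  shows "invertible (metric_mat c x)"
proof -
  note p = chart_inv_dom[OF x]
  have "w = 0" if w: "metric_mat c x *v w = 0" for w
  proof -
    let ?v = "tangent_vector \<A> c (chart_inv c x) w"
    have "a (chart_inv c x) ?v u = 0" if u: "u \<in> tangent_space \<A> (chart_inv c x)" for u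
      using metric_in_chart[OF c x, of w "u c"] tangent_space_eq[OF c p u] w
        symmetric_matrix_inner[OF metric_mat_sym[OF c x], of w "u c"] by simp
    then have "?v = (\<lambda>_. 0)"
      using metric chart_point[OF c x] tangent_vector_in[OF c p] by (simp add: pseudo_riemannian_metric_def)
    then show ?thesis using tangent_vector_self[OF c p, of w] by simp
  qed
  then show ?thesis
    using matrix_left_invertible_ker[of "metric_mat c x"] invertible_left_inverse by blast
qed

lemma metric_mat_smooth: "c \<in> \<A> \<Longrightarrow> smooth_on (chart_img c) (\<lambda>x. metric_mat c x $ i $ j)"
  using metric by (simp add: pseudo_riemannian_metric_def metric_mat_def)

lemma form_vec_smooth: "c \<in> \<A> \<Longrightarrow> smooth_on (chart_img c) (\<lambda>x. form_vec c x $ i)"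
  using form by (simp add: one_form_def form_vec_def)

lemma form_vec_nonnull:
  assumes "c \<in> \<A>" "x \<in> chart_img c"
  shows "form_vec c x \<bullet> (matrix_inv (metric_mat c x) *v form_vec c x) \<noteq> 0"
proof -
  have "form_norm_sq \<A> a b c x = form_vec c x \<bullet> (matrix_inv (metric_mat c x) *v form_vec c x)"
    by (simp add: form_norm_sq_def inverse_metric_comp_def metric_mat_def form_vec_def inner_vec_def
        matrix_vector_mult_def sum_distrib_left mult_ac)
  moreover have "form_norm_sq \<A> a b c x \<noteq> 0"
    using non_null assms by (simp add: nowhere_null_def)
  ultimately show ?thesis by simp
qed

text \<open>The chosen vector is the metric dual of \<open>b\<close>; this makes \<open>|b|\<^sup>2\<close> a function on the manifold
  without any comparison of charts.\<close>

definition sq_norm :: "'a \<Rightarrow> real" where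
  "sq_norm p = b p (SOME v. v \<in> tangent_space \<A> p \<and> (\<forall>w\<in>tangent_space \<A> p. a p v w = b p w))"

text \<open>Raising the index in the chart shows that a dual vector exists, and nondegeneracy forces
  the components of any such vector to be these. So the choice in \<open>sq_norm\<close> is
  harmless.\<close>

lemma sq_norm_in_chart:
  assumes c: "c \<in> \<A>" and x: "x \<in> chart_img c"
  shows "sq_norm (chart_inv c x) = form_vec c x \<bullet> (matrix_inv (metric_mat c x) *v form_vec c x)"
proof -
  let ?p = "chart_inv c x" and ?M = "metric_mat c x" and ?b = "form_vec c x"
  let ?P = "\<lambda>v. v \<in> tangent_space \<A> ?p \<and> (\<forall>w\<in>tangent_space \<A> ?p. a ?p v w = b ?p w)"
  note p = chart_inv_dom[OF x]
  note inv = matrix_inv_right_left[OF metric_mat_invertible[OF c x]]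
  have sym: "y \<bullet> (?M *v w) = (?M *v y) \<bullet> w" for y w
    using symmetric_matrix_inner[OF metric_mat_sym[OF c x], of y w] by (simp add: inner_commute)
  have "?P (tangent_vector \<A> c ?p (matrix_inv ?M *v ?b))"
  proof (intro conjI ballI tangent_vector_in c p)
    fix w assume "w \<in> tangent_space \<A> ?p"
    then have w: "w = tangent_vector \<A> c ?p (w c)" by (rule tangent_space_eq[OF c p])
    show "a ?p (tangent_vector \<A> c ?p (matrix_inv ?M *v ?b)) w = b ?p w"
      by (subst (1 2) w) (simp add: metric_in_chart[OF c x] form_in_chart[OF c x] sym matrix_vector_mul_assoc inv)
  qed
  then have v: "?P (SOME v. ?P v)" by (rule someI[of ?P])
  define v where "v = (SOME v. ?P v)"
  have veq: "v = tangent_vector \<A> c ?p (v c)"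
    using tangent_space_eq[OF c p] v by (simp add: v_def)
  have "(?M *v v c) \<bullet> w = ?b \<bullet> w" for w
  proof -
    have "a ?p v (tangent_vector \<A> c ?p w) = b ?p (tangent_vector \<A> c ?p w)"
      using v tangent_vector_in[OF c p] by (simp add: v_def)
    then show ?thesis
      by (subst (asm) veq) (simp add: metric_in_chart[OF c x] form_in_chart[OF c x] sym)
  qed
  then have "?M *v v c = ?b"
    by (metis vector_eq_ldot inner_commute)
  then have "v c = matrix_inv ?M *v ?b"
    by (metis inv(2) matrix_vector_mul_assoc matrix_vector_mul_lid)
  moreover have "sq_norm ?p = b ?p v" by (simp add: sq_norm_def v_def)
  ultimately show ?thesis using form_in_chart[OF c x, of "v c"] veq by simp
qed

lemma sq_norm_nonzero:
  assumes "p \<in> topspace X"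
  shows "sq_norm p \<noteq> 0"
proof -
  obtain c where c: "c \<in> \<A>" "p \<in> chart_dom c" using assms chart_cover by blast
  note x = chart_map_img[OF c(2)]
  show ?thesis
    using sq_norm_in_chart[OF c(1) x] form_vec_nonnull[OF c(1) x] chart_inv_map[OF c] by simp
qed

end

subsection \<open>The parallel conformal metric\<close>

lemma real_power_sqrt_squared:
  assumes "Q \<noteq> 0"
  shows "(real_power (sqrt \<bar>Q\<bar>) r)\<^sup>2 = \<bar>Q\<bar> powr r"
proof -
  have "\<bar>Q\<bar> powr r = (sqrt \<bar>Q\<bar> * sqrt \<bar>Q\<bar>) powr r" by simp
  also have "\<dots> = (sqrt \<bar>Q\<bar> powr r)\<^sup>2" by (simp only: powr_mult power2_eq_square)
  finally show ?thesis by (simp add: real_power_def)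
qed

text \<open>A negative base comes with an integer exponent, and squaring removes the sign of the
  power.\<close>

lemma real_power_squared:
  assumes "B \<noteq> 0" "real_power_defined B r"
  shows "(real_power B r)\<^sup>2 = \<bar>B\<bar> powr (2 * r)"
proof -
  have "\<bar>real_power B r\<bar> = \<bar>B\<bar> powr r"
  proof (cases "B < 0")
    case True
    then obtain n where "r = of_int n" using assms by (auto simp: real_power_defined_def elim: Ints_cases)
    then show ?thesis
      using True powr_real_of_int'[of "\<bar>B\<bar>" n] by (simp add: real_power_def power_int_abs)
  qed (simp add: real_power_def)
  then have "(real_power B r)\<^sup>2 = (\<bar>B\<bar> powr r)\<^sup>2" by (metis power2_abs)
  also have "\<dots> = \<bar>B\<bar> powr (2 * r)" by (simp add: power2_eq_square powr_add[symmetric])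
  finally show ?thesis .
qed

context metric_form_manifold
begin

text \<open>The passage from the manifold to coordinates. Bilinearity turns the values of a and b on
  tangent vectors into matrix expressions, and squaring F turns the signed real powers into powers
  of absolute values.\<close>

lemma kropina_energy_in_chart:
  assumes kropina: "kropina_metric X \<A> m a b A F" and \<Gamma>: "affine_connection_of \<A> A F \<Gamma>"
    and m: "m \<noteq> 0" and dim: "CARD('n) > 1" and c: "c \<in> \<A>"
  shows "kropina_energy (local_domain \<A> A c) (\<lambda>u. (local_rep \<A> F c u)\<^sup>2) (\<Gamma> c)
    (fundamental_tensor \<A> F c) (chart_img c) (metric_mat c) (form_vec c) m"
proof -
  let ?D = "local_domain \<A> A c" and ?E = "\<lambda>u. (local_rep \<A> F c u)\<^sup>2"
  have F: "finsler_metric X \<A> A F" and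
    F_eq: "\<And>p v. (p, v) \<in> A \<Longrightarrow> real_power_defined (b p v) (- m) \<and>
        F (p, v) = real_power (sqrt \<bar>a p v v\<bar>) (1 + m) * real_power (b p v) (- m)"
    using kropina by (auto simp: kropina_metric_def Let_def)
  have A: "A \<subseteq> tangent_bundle X \<A>" "open ?D" "fst ` A = topspace X"
    and scale: "\<And>p v r. (p, v) \<in> A \<Longrightarrow> r > 0 \<Longrightarrow> (p, tvec_scale r v) \<in> A \<and> F (p, tvec_scale r v) = r * F (p, v)"
    using F c by (auto simp: finsler_metric_def conic_subbundle_def)
  have D: "(x, y) \<in> ?D \<longleftrightarrow> x \<in> chart_img c \<and> (chart_inv c x, tangent_vector \<A> c (chart_inv c x) y) \<in> A" for x y
    by (simp add: local_domain_def bundle_point_def)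
  have rep: "local_rep \<A> F c (x, y) = F (chart_inv c x, tangent_vector \<A> c (chart_inv c x) y)" for x y
    by (simp add: local_rep_def bundle_point_def)
  show ?thesis
  proof (intro kropina_energy.intro berwald_energy.intro kropina_energy_axioms.intro)
    show "open ?D" by (rule A)
    show "fibre_cone ?D"
      using scale by (auto simp: fibre_cone_def D tangent_vector_scale[OF c chart_inv_dom])
    have "smooth_on ?D (local_rep \<A> F c)" using F c by (simp add: finsler_metric_def)
    then show "smooth_on ?D ?E"
      unfolding power2_eq_square by (intro smooth_on_mult A)
    show "fibre_homogeneous ?D 2 ?E"
      using scale by (auto simp: fibre_homogeneous_def D rep tangent_vector_scale[OF c chart_inv_dom] power_mult_distrib)
    show "fundamental_tensor \<A> F c = (\<lambda>z. \<chi> i j. dy i (dy j (\<lambda>u. 1/2 * ?E u)) z)"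
      by (simp add: fundamental_tensor_def fun_eq_iff)
    show "invertible (fundamental_tensor \<A> F c z)" if "z \<in> ?D" for z
      using F c that by (simp add: finsler_metric_def)
    have conn: "nonlinear_connection \<A> F c j i z = (\<Sum>l\<in>UNIV. \<Gamma> c j i l (fst z) * snd z $ l)"
      if "z \<in> ?D" for z i j
      using \<Gamma> c that unfolding affine_connection_of_def by blast
    show "1/4 * dy i (\<lambda>u. \<Sum>k\<in>UNIV. matrix_inv (fundamental_tensor \<A> F c u) $ j $ k *
             ((\<Sum>l\<in>UNIV. snd u $ l * dx l (dy k ?E) u) - dx k ?E u)) z
        = (\<Sum>l\<in>UNIV. \<Gamma> c j i l (fst z) * snd z $ l)" if "z \<in> ?D" for z i j
      using conn[OF that] unfolding nonlinear_connection_def Let_def .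
    show "open (chart_img c)" by (rule chart_img_open[OF c])
    show "fst ` ?D = chart_img c"
    proof
      show "fst ` ?D \<subseteq> chart_img c" by (auto simp: D)
      show "chart_img c \<subseteq> fst ` ?D"
      proof
        \<comment> \<open>The projection of \<open>A\<close> is onto, so there is a vector of
          \<open>A\<close> over the point; its component in \<open>c\<close> is the required fibre
          coordinate.\<close>
        fix x assume x: "x \<in> chart_img c"
        obtain v where v: "(chart_inv c x, v) \<in> A"
          using chart_point[OF c x] unfolding A(3)[symmetric] by force
        then have "v \<in> tangent_space \<A> (chart_inv c x)"
          using A(1) unfolding tangent_bundle_def by blast
        with v have "(chart_inv c x, tangent_vector \<A> c (chart_inv c x) (v c)) \<in> A"
          by (subst (asm) tangent_space_eq[OF c chart_inv_dom[OF x]])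
        then have "(x, v c) \<in> ?D" using x D by blast
        then show "x \<in> fst ` ?D" by force
      qed
    qed
    show "?E (x, y) = \<bar>y \<bullet> (metric_mat c x *v y)\<bar> powr (1 + m) * \<bar>form_vec c x \<bullet> y\<bar> powr (-2 * m)"
      if "(x, y) \<in> ?D" "y \<bullet> (metric_mat c x *v y) \<noteq> 0" "form_vec c x \<bullet> y \<noteq> 0" for x y
      using F_eq[of "chart_inv c x" "tangent_vector \<A> c (chart_inv c x) y"] that
        real_power_sqrt_squared[of "y \<bullet> (metric_mat c x *v y)" "1 + m"]
        real_power_squared[of "form_vec c x \<bullet> y" "- m"]
      by (simp add: D rep metric_in_chart[OF c] form_in_chart[OF c] power_mult_distrib)
  qed (use c m dim in \<open>auto intro: metric_mat_smooth metric_mat_sym metric_mat_invertible form_vec_smooth dest: form_vec_nonnull\<close>)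
qed

text \<open>Built from \<open>sq_norm\<close>, a function of the point alone, so nothing has to be
  glued.\<close>

definition conformal_metric :: "real \<Rightarrow> 'a \<Rightarrow> ('a, 'n) tvec \<Rightarrow> ('a, 'n) tvec \<Rightarrow> real" where
  "conformal_metric m p v w = \<bar>sq_norm p\<bar> powr (- m) * a p v w"

lemma conformal_metric_comp:
  assumes "c \<in> \<A>" "x \<in> chart_img c"
  shows "metric_comp \<A> (conformal_metric m) c i j x
    = \<bar>form_vec c x \<bullet> (matrix_inv (metric_mat c x) *v form_vec c x)\<bar> powr (- m) * metric_mat c x $ i $ j"
  using sq_norm_in_chart[OF assms]
  by (simp add: metric_comp_def conformal_metric_def Let_def metric_mat_def)

text \<open>The given symbols of F are themselves the witness. \<open>kropina_energy\<close> is
  interpreted afresh in each chart, and \<open>comp\<close> identifies every local \<open>g\<close>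
  with the one global metric.\<close>

lemma kropina_metrizable:
  assumes kropina: "kropina_metric X \<A> m a b A F" and \<Gamma>: "affine_connection_of \<A> A F \<Gamma>"
    and m: "m \<noteq> 0" and dim: "CARD('n) > 1"
  shows "metrizable X \<A> A F"
proof -
  let ?g = "conformal_metric m"
  have comp: "metric_comp \<A> ?g c i j x = kropina_energy.g (metric_mat c) (form_vec c) m x $ i $ j"
    if c: "c \<in> \<A>" and x: "x \<in> chart_img c" for c i j x
  proof -
    interpret kropina_energy "local_domain \<A> A c" "\<lambda>u. (local_rep \<A> F c u)\<^sup>2" "\<Gamma> c"
      "fundamental_tensor \<A> F c" "chart_img c" "metric_mat c" "form_vec c" m
      by (rule kropina_energy_in_chart[OF assms c])
    show ?thesis by (simp add: conformal_metric_comp[OF c x] g_def norm_sq_def \<beta>_def)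
  qed
  have smooth: "smooth_on (chart_img c) (metric_comp \<A> ?g c i j)" if c: "c \<in> \<A>" for c i j
  proof -
    interpret kropina_energy "local_domain \<A> A c" "\<lambda>u. (local_rep \<A> F c u)\<^sup>2" "\<Gamma> c"
      "fundamental_tensor \<A> F c" "chart_img c" "metric_mat c" "form_vec c" m
      by (rule kropina_energy_in_chart[OF assms c])
    have "smooth_on (chart_img c) (\<lambda>x. \<bar>norm_sq x\<bar> powr (- m) * metric_mat c x $ i $ j)"
      by (intro smooth_on_mult smooth_on_abs_powr U smooth_norm_sq norm_sq_nonzero metric_mat_smooth c)
    then show ?thesis
      by (rule smooth_on_cong[OF U(1)]) (simp add: comp[OF c] g_def)
  qed
  have "pseudo_riemannian_metric X \<A> ?g"
    unfolding pseudo_riemannian_metric_def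
  proof (intro conjI ballI allI impI smooth)
    fix p v assume p: "p \<in> topspace X" and v: "v \<in> tangent_space \<A> p"
    have "linear_on_tangent \<A> p (a p v)"
      using metric p v by (simp add: pseudo_riemannian_metric_def)
    then show "linear_on_tangent \<A> p (?g p v)"
      by (simp add: linear_on_tangent_def conformal_metric_def algebra_simps)
    show "?g p v w = ?g p w v" if "w \<in> tangent_space \<A> p" for w
      using metric p v that by (simp add: pseudo_riemannian_metric_def conformal_metric_def)
    show "v = (\<lambda>_. 0)" if "\<forall>w\<in>tangent_space \<A> p. ?g p v w = 0"
      using metric p v that sq_norm_nonzero[OF p]
      by (simp add: pseudo_riemannian_metric_def conformal_metric_def)
  qed
  moreover have "\<Gamma> c k i j x = christoffel \<A> ?g c k i j x" if c: "c \<in> \<A>" and x: "x \<in> chart_img c" for c x k i j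
  proof -
    interpret kropina_energy "local_domain \<A> A c" "\<lambda>u. (local_rep \<A> F c u)\<^sup>2" "\<Gamma> c"
      "fundamental_tensor \<A> F c" "chart_img c" "metric_mat c" "form_vec c" m
      by (rule kropina_energy_in_chart[OF assms c])
    have "dir_deriv v (metric_comp \<A> ?g c i j) x = dir_deriv v (\<lambda>x. g x $ i $ j) x" for v i j
      by (intro dir_deriv_cong[OF U(1) x] comp[OF c])
    moreover have "(\<chi> k l. metric_comp \<A> ?g c k l x) = g x"
      by (simp add: vec_eq_iff comp[OF c x])
    ultimately show ?thesis
      unfolding christoffel_def inverse_metric_comp_def by (simp only: connection_is_levi_civita[OF x])
  qed
  ultimately show ?thesis
    unfolding metrizable_def using \<Gamma> by blast
qed

end

theorem corollary14:
  fixes X :: "'a topology"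
    and \<A> :: "('a, 'n::finite) chart set"
    and A :: "('a \<times> ('a, 'n) tvec) set"
    and F :: "'a \<times> ('a, 'n) tvec \<Rightarrow> real"
    and a :: "'a \<Rightarrow> ('a, 'n) tvec \<Rightarrow> ('a, 'n) tvec \<Rightarrow> real"
    and b :: "'a \<Rightarrow> ('a, 'n) tvec \<Rightarrow> real"
    and m :: real
  assumes "smooth_manifold X \<A>"
    and "CARD('n) > 2"
    and "m \<noteq> 0"
    and "kropina_metric X \<A> m a b A F"
    and "berwald X \<A> A F"
    and "nowhere_null \<A> a b"
  shows "metrizable X \<A> A F"
proof -
  obtain \<Gamma> where \<Gamma>: "affine_connection_of \<A> A F \<Gamma>"
    using assms(5) by (auto simp: berwald_def)
  interpret metric_form_manifold X \<A> a b
    using assms(1,4,6) by unfold_locales (simp_all add: kropina_metric_def)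
  show ?thesis
    using kropina_metrizable[OF assms(4) \<Gamma> assms(3)] assms(2) by simp
qed

end
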